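(* Let $A,B,A',B'$ be finite-dimensional quantum systems with $d_Ad_B=d_{A'}d_{B'}$. The signalling $\mathcal U\mapsto\Sigma(\mathcal U)$ and the causal influence $\mathcal U\mapsto C(\mathcal U)$ are continuous functions from $\mathfrak U(AB,A'B')$ to $[0,2]$.
   Context: All systems are finite-dimensional quantum systems; system $X$ has complex Hilbert space $\mathcal H_X$ of dimension $d_X$, and the composite system $XY$ has Hilbert space $\mathcal H_X\otimes\mathcal H_Y$. $\mathsf{St}(X)$ is the set of density operators on $\mathcal H_X$. $\mathfrak C(X,Y)$ is the set of quantum channels (completely positive trace-preserving linear maps) from operators on $\mathcal H_X$ to operators on $\mathcal H_Y$, and $\mathfrak C(X)=\mathfrak C(X,X)$. $\mathcal I_X$ is the identity channel on $X$. $\mathfrak U(AB,A'B')$ is the set of unitary channels $\rho\mapsto U\rho U^\dagger$ with $U:\mathcal H_A\otimes\mathcal H_B\to\mathcal H_{A'}\otimes\mathcal H_{B'}$ unitary; it is given the topology induced by the diamond norm (equivalently, by any norm on the finite-dimensional space of linear maps). $\|X\|_1=\mathrm{Tr}\sqrt{X^\dagger X}$. For a Hermitian-preserving linear map $\mathcal L$ with input system $X$, the diamond norm is $\|\mathcal L\|_\diamond=\sup_{\rho\in\mathsf{St}(EX)}\|(\mathcal I_E\otimes\mathcal L)(\rho)\|_1$ with $E\cong X$. For $\mathcal U\in\mathfrak U(AB,A'B')$, the channel $\mathcal T(\mathcal U)\in\mathfrak C(AA'B')$ is $\mathcal T(\mathcal U)=(\mathcal I_A\otimes\mathcal U)\circ(\mathcal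 S_{AA}\otimes\mathcal I_B)\circ(\mathcal I_A\otimes\mathcal U^{-1})$, where $\mathcal S_{AA}$ is the swap of two copies of $A$. The signalling (from $A$ to $B'$) and the causal influence (from $A$ to $B'$) of $\mathcal U$ are $$\Sigma(\mathcal U)=\inf_{\mathcal C\in\mathfrak C(B,B')}\|(\mathrm{Tr}_{A'}\otimes\mathcal I_{B'})\circ\mathcal U-\mathrm{Tr}_A\otimes\mathcal C\|_\diamond,\qquad C(\mathcal U)=\inf_{\mathcal C\in\mathfrak C(AA')}\|\mathcal T(\mathcal U)-\mathcal C\otimes\mathcal I_{B'}\|_\diamond .$$ *)

theory Defs
  imports "HOL-Analysis.Analysis"
begin

text \<open>
  A system \<open>X\<close> of dimension \<open>d\<close> is represented by a finite index type \<open>'x\<close> with \<open>CARD('x) = d\<close>: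
  its Hilbert space is \<open>complex ^ 'x\<close>, its operators are complex matrices, and the composite of
  \<open>X\<close> and \<open>Y\<close> is indexed by \<open>'x \<times> 'y\<close>.
\<close>

type_synonym 'x oper = "((complex, 'x) vec, 'x) vec"

definition cscale :: "complex \<Rightarrow> 'x::finite oper \<Rightarrow> 'x oper" where
  "cscale c M = (\<chi> i j. c * M $ i $ j)"

definition dagger :: "complex ^ 'x ^ 'y \<Rightarrow> complex ^ 'y ^ 'x" where
  "dagger M = (\<chi> i j. cnj (M $ j $ i))"

definition cinner :: "complex ^ 'x \<Rightarrow> complex ^ 'x \<Rightarrow> complex" where
  "cinner v w = (\<Sum>i\<in>UNIV. cnj (v $ i) * w $ i)"

definition positive_op :: "'x::finite oper \<Rightarrow> bool" where
  "positive_op M \<longleftrightarrow> (\<forall>v. cinner v (M *v v) \<in> \<real>\<^sub>\<ge>\<^sub>0)"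

definition sqrt_op :: "'x::finite oper \<Rightarrow> 'x oper" where
  "sqrt_op M = (THE P. positive_op P \<and> P ** P = M)"

text \<open>The trace of a positive operator is real, so taking \<open>Re\<close> only changes the type.\<close>

definition trace_norm :: "'x::finite oper \<Rightarrow> real" where
  "trace_norm M = Re (trace (sqrt_op (dagger M ** M)))"

definition density_ops :: "'x::finite oper set" where
  "density_ops = {\<rho>. positive_op \<rho> \<and> trace \<rho> = 1}"


definition linear_map :: "('x::finite oper \<Rightarrow> 'y::finite oper) \<Rightarrow> bool" where
  "linear_map L \<longleftrightarrow> Vector_Spaces.linear cscale cscale L"

text \<open>
  Complete positivity quantifies over ancillas of every dimension \<open>n\<close>, which cannot be done by a
  type. An operator on the tensor product of \<open>\<complex>\<^sup>n\<close> with the space of \<open>X\<close> is therefore written as an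
  \<open>n \<times> n\<close> array \<open>M\<close> of operators on \<open>X\<close>, of which only the entries \<open>M i j\<close> with \<open>i, j < n\<close>
  matter; a vector is an \<open>n\<close>-tuple \<open>v\<close>, and the identity on the ancilla tensored
  with \<open>L\<close> applies \<open>L\<close> to every block.
\<close>

definition positive_block :: "nat \<Rightarrow> (nat \<Rightarrow> nat \<Rightarrow> 'x::finite oper) \<Rightarrow> bool" where
  "positive_block n M \<longleftrightarrow>
     (\<forall>v. (\<Sum>i<n. \<Sum>j<n. cinner (v i) (M i j *v v j)) \<in> \<real>\<^sub>\<ge>\<^sub>0)"

definition completely_positive :: "('x::finite oper \<Rightarrow> 'y::finite oper) \<Rightarrow> bool" where
  "completely_positive L \<longleftrightarrow>
     (\<forall>n M. positive_block n M \<longrightarrow> positive_block n (\<lambda>i j. L (M i j)))"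

definition trace_preserving :: "('x::finite oper \<Rightarrow> 'y::finite oper) \<Rightarrow> bool" where
  "trace_preserving L \<longleftrightarrow> (\<forall>M. trace (L M) = trace M)"

definition channels :: "('x::finite oper \<Rightarrow> 'y::finite oper) set" where
  "channels = {L. linear_map L \<and> completely_positive L \<and> trace_preserving L}"

definition unitary_op :: "complex ^ 'x ^ 'y \<Rightarrow> bool" where
  "unitary_op U \<longleftrightarrow> dagger U ** U = mat 1 \<and> U ** dagger U = mat 1"

definition unitary_channels :: "('x::finite oper \<Rightarrow> 'y::finite oper) set" where
  "unitary_channels =
     {\<U>. \<exists>U :: complex ^ 'x ^ 'y. unitary_op U \<and> \<U> = (\<lambda>\<rho>. U ** \<rho> ** dagger U)}"


definition tensor_op :: "'x::finite oper \<Rightarrow> 'y::finite oper \<Rightarrow> ('x \<times> 'y) oper" where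
  "tensor_op M N = (\<chi> p q. M $ fst p $ fst q * N $ snd p $ snd q)"

definition matrix_unit :: "'x::finite \<Rightarrow> 'x \<Rightarrow> 'x oper" where
  "matrix_unit k l = (\<chi> i j. if i = k \<and> j = l then 1 else 0)"

text \<open>
  For linear \<open>L\<close> and \<open>K\<close> this is the linear map sending \<open>tensor_op M N\<close> to
  \<open>tensor_op (L M) (K N)\<close> (lemma \<open>tensor_map_tensor_op\<close> below), given by its values on
  products of matrix units.
\<close>

definition tensor_map ::
  "('x::finite oper \<Rightarrow> 'y::finite oper) \<Rightarrow> ('z::finite oper \<Rightarrow> 'w::finite oper) \<Rightarrow>
     ('x \<times> 'z) oper \<Rightarrow> ('y \<times> 'w) oper" where
  "tensor_map L K M =
     (\<Sum>(i, j)\<in>UNIV. \<Sum>(k, l)\<in>UNIV.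
        cscale (M $ (i, j) $ (k, l)) (tensor_op (L (matrix_unit i k)) (K (matrix_unit j l))))"

lemma linear_map_matrix_units:
  assumes "linear_map L"
  shows "L M $ p $ q = (\<Sum>i\<in>UNIV. \<Sum>k\<in>UNIV. M $ i $ k * L (matrix_unit i k) $ p $ q)"
proof -
  interpret Vector_Spaces.linear cscale cscale L
    using assms by (simp add: linear_map_def)
  have M: "M = (\<Sum>i\<in>UNIV. \<Sum>k\<in>UNIV. cscale (M $ i $ k) (matrix_unit i k))"
  proof -
    have "(\<Sum>i\<in>UNIV. \<Sum>k\<in>UNIV. cscale (M $ i $ k) (matrix_unit i k)) $ p $ q =
        (\<Sum>i\<in>UNIV. \<Sum>k\<in>UNIV. if i = p then if k = q then M $ i $ k else 0 else 0)" for p q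
      by (auto simp: cscale_def matrix_unit_def intro!: sum.cong)
    also have "\<dots> p q = M $ p $ q" for p q
      by (subst sum.swap) simp
    finally show ?thesis by (simp add: vec_eq_iff)
  qed
  have "L M = (\<Sum>i\<in>UNIV. \<Sum>k\<in>UNIV. cscale (M $ i $ k) (L (matrix_unit i k)))"
    by (subst M) (simp add: sum scale)
  then show ?thesis by (simp add: cscale_def)
qed

lemma sum_UNIV_prod:
  "(\<Sum>x\<in>UNIV. f x) = (\<Sum>i\<in>UNIV. \<Sum>j\<in>UNIV. f (i, j))"
  for f :: "'x::finite \<times> 'y::finite \<Rightarrow> 'c::comm_monoid_add"
  by (simp add: sum.cartesian_product)

lemma tensor_map_tensor_op:
  assumes "linear_map L" and "linear_map K"
  shows "tensor_map L K (tensor_op M N) = tensor_op (L M) (K N)"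
proof -
  have "tensor_map L K (tensor_op M N) $ p $ q = tensor_op (L M) (K N) $ p $ q" for p q
  proof -
    have "tensor_map L K (tensor_op M N) $ p $ q =
      (\<Sum>i\<in>UNIV. \<Sum>j\<in>UNIV. \<Sum>k\<in>UNIV. \<Sum>l\<in>UNIV.
        (M $ i $ k * L (matrix_unit i k) $ fst p $ fst q) *
        (N $ j $ l * K (matrix_unit j l) $ snd p $ snd q))"
      by (simp only: tensor_map_def tensor_op_def cscale_def sum_component vec_lambda_beta
          case_prod_beta fst_conv snd_conv sum_UNIV_prod mult_ac)
    also have "\<dots> = (\<Sum>i\<in>UNIV. \<Sum>k\<in>UNIV. M $ i $ k * L (matrix_unit i k) $ fst p $ fst q) *
        (\<Sum>j\<in>UNIV. \<Sum>l\<in>UNIV. N $ j $ l * K (matrix_unit j l) $ snd p $ snd q)"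
      by (simp only: sum_product)
    also have "\<dots> = tensor_op (L M) (K N) $ p $ q"
      by (simp add: tensor_op_def linear_map_matrix_units[OF assms(1), of M]
          linear_map_matrix_units[OF assms(2), of N])
    finally show ?thesis .
  qed
  then show ?thesis by (simp add: vec_eq_iff)
qed

text \<open>
  Meant for Hermitian-preserving \<open>L\<close>; the ancilla is a copy of the input system.
\<close>

definition diamond_norm :: "('x::finite oper \<Rightarrow> 'y::finite oper) \<Rightarrow> real" where
  "diamond_norm L =
     (SUP \<rho>\<in>(density_ops :: ('x \<times> 'x) oper set). trace_norm (tensor_map id L \<rho>))"

definition unitary_topology :: "('x::finite oper \<Rightarrow> 'y::finite oper) topology" where
  "unitary_topology =
     Metric_space.mtopology unitary_channels (\<lambda>\<U> \<V>. diamond_norm (\<lambda>\<rho>. \<U> \<rho> - \<V> \<rho>))"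


text \<open>
  The trace as a map to the operators of the trivial system, whose Hilbert space
  \<open>complex ^ unit\<close> is one-dimensional. The trivial factor is kept in composites,
  so \<open>tensor_map trace_map id\<close> has output system \<open>unit \<times> 'y\<close>.
\<close>

definition trace_map :: "'x::finite oper \<Rightarrow> unit oper" where
  "trace_map M = (\<chi> i j. trace M)"

definition reindex :: "('y::finite \<Rightarrow> 'x::finite) \<Rightarrow> 'x oper \<Rightarrow> 'y oper" where
  "reindex f M = (\<chi> i j. M $ f i $ f j)"

definition swap_map :: "('x::finite \<times> 'x) oper \<Rightarrow> ('x \<times> 'x) oper" where
  "swap_map = reindex prod.swap"

text \<open>The identification of \<open>X(YZ)\<close> with \<open>(XY)Z\<close>, in both directions.\<close>

definition assoc_left :: "('x::finite \<times> ('y::finite \<times> 'z::finite)) oper \<Rightarrow> (('x \<times> 'y) \<times> 'z) oper" where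
  "assoc_left = reindex (\<lambda>((i, j), k). (i, (j, k)))"

definition assoc_right :: "(('x::finite \<times> 'y::finite) \<times> 'z::finite) oper \<Rightarrow> ('x \<times> ('y \<times> 'z)) oper" where
  "assoc_right = reindex (\<lambda>(i, (j, k)). ((i, j), k))"

definition signalling ::
  "(('a::finite \<times> 'b::finite) oper \<Rightarrow> ('a'::finite \<times> 'b'::finite) oper) \<Rightarrow> real" where
  "signalling \<U> =
     (INF \<C>\<in>(channels :: ('b oper \<Rightarrow> 'b' oper) set).
        diamond_norm (\<lambda>\<rho>. tensor_map trace_map id (\<U> \<rho>) - tensor_map trace_map \<C> \<rho>))"

definition T_map ::
  "(('a::finite \<times> 'b::finite) oper \<Rightarrow> ('a'::finite \<times> 'b'::finite) oper) \<Rightarrow>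
     ('a \<times> ('a' \<times> 'b')) oper \<Rightarrow> ('a \<times> ('a' \<times> 'b')) oper" where
  "T_map \<U> =
     tensor_map id \<U> \<circ> (assoc_right \<circ> tensor_map swap_map id \<circ> assoc_left) \<circ> tensor_map id (inv \<U>)"

definition causal_influence ::
  "(('a::finite \<times> 'b::finite) oper \<Rightarrow> ('a'::finite \<times> 'b'::finite) oper) \<Rightarrow> real" where
  "causal_influence \<U> =
     (INF \<C>\<in>(channels :: (('a \<times> 'a') oper \<Rightarrow> ('a \<times> 'a') oper) set).
        diamond_norm (\<lambda>\<rho>. T_map \<U> \<rho> - assoc_right (tensor_map \<C> id (assoc_left \<rho>))))"

end

theory Submission
  imports Defs
begin

text \<open>
  Both quantities are the diamond distance from a channel \<open>F \<U>\<close> to a fixed nonempty set of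
  channels: \<open>F \<U>\<close> is \<open>\<U>\<close> followed by the partial trace for signalling, and \<open>T_map \<U>\<close> for the
  causal influence. Two channels are at distance at most 2, because the trace norm of \<open>P - Q\<close> with
  \<open>P\<close> and \<open>Q\<close> positive is at most \<open>trace P + trace Q\<close>. The distance to a set is 1-Lipschitz, so it
  remains to see that \<open>F\<close> is Lipschitz. Constants do not matter for that: the diamond norm is
  equivalent to the operator norm induced by the Frobenius norms, for which tensoring with the
  identity is bounded and unitary channels are isometric, and
  \<open>\<U>\<^sup>-\<^sup>1 - \<V>\<^sup>-\<^sup>1 = \<U>\<^sup>-\<^sup>1 \<circ> (\<V> - \<U>) \<circ> \<V>\<^sup>-\<^sup>1\<close> handles the inverse in \<open>T_map\<close>.
  The triangle inequality for the trace norm of Hermitian matrices comes from the spectral theorem.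
\<close>

section \<open>Hermitian matrices\<close>

lemma dagger_nth [simp]: "dagger M $ i $ j = cnj (M $ j $ i)"
  by (simp add: dagger_def)

lemma cscale_nth [simp]: "cscale c M $ i $ j = c * M $ i $ j"
  by (simp add: cscale_def)

lemma dagger_dagger [simp]: "dagger (dagger M) = M"
  by (simp add: vec_eq_iff)

lemma dagger_add: "dagger (M + N) = dagger M + dagger N"
  by (simp add: vec_eq_iff)

lemma dagger_diff: "dagger (M - N) = dagger M - dagger N"
  by (simp add: vec_eq_iff)

lemma dagger_cscale: "dagger (cscale c M) = cscale (cnj c) (dagger M)"
  by (simp add: vec_eq_iff)

lemma dagger_matrix_mul: "dagger (M ** N) = dagger N ** dagger M"
  for M :: "complex ^ 'x::finite ^ 'y" and N :: "complex ^ 'z ^ 'x"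
  by (simp add: vec_eq_iff matrix_matrix_mult_def mult.commute)

lemma cinner_adjoint: "cinner (dagger M *v v) w = cinner v (M *v w)"
  for M :: "complex ^ 'x::finite ^ 'y::finite"
  unfolding cinner_def matrix_vector_mult_def
  by (simp add: sum_distrib_left sum_distrib_right mult_ac) (rule sum.swap)

lemma cinner_commute: "cinner v w = cnj (cinner w v)"
  by (simp add: cinner_def mult.commute)

lemma cinner_add_right: "cinner u (v + w) = cinner u v + cinner u w"
  by (simp add: cinner_def sum.distrib algebra_simps)

lemma cinner_scale_right: "cinner u (c *s v) = c * cinner u v"
  by (simp add: cinner_def sum_distrib_left mult_ac)

lemma inner_eq_Re_cinner: "v \<bullet> w = Re (cinner v w)"
  for v w :: "complex ^ 'x::finite"
  by (simp add: inner_vec_def cinner_def inner_complex_def)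

text \<open>The real inner product sees only the real part of \<open>cinner\<close>; rotating the
  first argument by \<open>\<i>\<close> exposes the imaginary part. Complex orthogonality to
  \<open>v\<close> is therefore real orthogonality to \<open>v\<close> and
  \<open>\<i> *s v\<close>.\<close>

lemma inner_i_eq_Im_cinner: "(\<i> *s v) \<bullet> w = Im (cinner v w)"
  for v w :: "complex ^ 'x::finite"
  by (simp add: inner_vec_def cinner_def inner_complex_def algebra_simps)

lemma cinner_self: "cinner v v = of_real ((norm v)\<^sup>2)"
  for v :: "complex ^ 'x::finite"
proof -
  have "Im (cinner v v) = 0"
    using cinner_commute[of v v] by (simp add: complex_eq_iff)
  then show ?thesis
    using inner_eq_Re_cinner[of v v] by (simp add: complex_eq_iff dot_square_norm)
qed

text \<open>A maximiser of the Rayleigh quotient on the unit sphere of the invariant subspace.\<close>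

lemma selfadjoint_eigenvector:
  fixes T :: "'a::euclidean_space \<Rightarrow> 'a"
  assumes T: "linear T" and sa: "\<And>x y. T x \<bullet> y = x \<bullet> T y"
    and W: "subspace W" and TW: "\<And>w. w \<in> W \<Longrightarrow> T w \<in> W"
    and w0: "w0 \<in> W" "w0 \<noteq> 0"
  obtains v m where "v \<in> W" "norm v = 1" "T v = m *\<^sub>R v"
proof -
  interpret T: linear T by fact
  define K where "K = W \<inter> sphere 0 1"
  have "compact K"
    unfolding K_def by (intro closed_Int_compact closed_subspace W compact_sphere)
  moreover have "inverse (norm w0) *\<^sub>R w0 \<in> K"
    using w0 W by (simp add: K_def subspace_scale)
  then have "K \<noteq> {}" by blast
  moreover have "continuous_on K (\<lambda>v. v \<bullet> T v)"
    by (intro continuous_intros linear_continuous_on T linear_conv_bounded_linear[THEN iffD1])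
  ultimately obtain v where v: "v \<in> K" and max: "\<And>w. w \<in> K \<Longrightarrow> w \<bullet> T w \<le> v \<bullet> T v"
    using continuous_attains_sup[of K "\<lambda>v. v \<bullet> T v"] by blast
  define m where "m = v \<bullet> T v"
  have vW: "v \<in> W" and nv: "norm v = 1" and vv: "v \<bullet> v = 1"
    using v by (auto simp: K_def norm_eq_1)
  have ray: "w \<bullet> T w \<le> m * (w \<bullet> w)" if "w \<in> W" for w
  proof (cases "w = 0")
    case False
    let ?c = "inverse (norm w)"
    have "?c *\<^sub>R w \<in> K"
      using that False W by (simp add: K_def subspace_scale)
    from max[OF this] have "?c * (?c * (w \<bullet> T w)) \<le> m"
      by (simp add: m_def T.scaleR)
    then have "w \<bullet> T w \<le> m * (norm w)\<^sup>2"
      using False by (simp add: field_simps power2_eq_square)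
    then show ?thesis by (simp add: dot_square_norm)
  qed simp
  \<comment> \<open>The residual of the eigenvector equation. Testing the maximality of
    \<open>v\<close> in this direction forces it to vanish.\<close>
  define w where "w = m *\<^sub>R v - T v"
  have wW: "w \<in> W"
    unfolding w_def by (intro subspace_diff subspace_scale W TW vW)
  define s where "s = m * (w \<bullet> w) - w \<bullet> T w"
  have s: "s \<ge> 0" using ray[OF wW] by (simp add: s_def)
  define r where "r = w \<bullet> w"
  \<comment> \<open>The Rayleigh bound at \<open>v + t w\<close>, expanded in \<open>t\<close>. The
    constant terms cancel because \<open>v\<close> attains the maximum, and the linear coefficient
    is \<open>2 * r\<close> because \<open>w\<close> is the residual.\<close>
  have q: "0 \<le> 2 * t * r + t\<^sup>2 * s" for t
  proof -
    have "v + t *\<^sub>R w \<in> W" by (intro subspace_add subspace_scale W wW vW)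
    from ray[OF this]
    have "0 \<le> m * (1 + 2 * t * (v \<bullet> w) + t\<^sup>2 * (w \<bullet> w)) - (m + 2 * t * (T v \<bullet> w) + t\<^sup>2 * (w \<bullet> T w))"
      by (simp add: T.add T.scaleR inner_add_left inner_add_right vv m_def[symmetric] sa
          inner_commute[of w v] inner_commute[of w "T v"] algebra_simps power2_eq_square)
    also have "\<dots> = 2 * t * (m * (v \<bullet> w) - T v \<bullet> w) + t\<^sup>2 * s"
      by (simp add: s_def algebra_simps)
    also have "m * (v \<bullet> w) - T v \<bullet> w = r"
      by (simp add: r_def w_def inner_diff_left)
    finally show ?thesis .
  qed
  have "r = 0"
  proof (rule ccontr)
    assume "r \<noteq> 0"
    then have "r > 0" by (simp add: r_def)
    \<comment> \<open>The quadratic in \<open>t\<close> would be smallest at \<open>- r / s\<close>;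
      using \<open>s + 1\<close> also covers \<open>s = 0\<close> and still gives a negative
      value.\<close>
    have "2 * (- (r / (s + 1))) * r + (- (r / (s + 1)))\<^sup>2 * s = - (r\<^sup>2 * (s + 2) / (s + 1)\<^sup>2)"
      using s by (simp add: divide_simps power2_eq_square) (simp add: algebra_simps)
    moreover have "r\<^sup>2 * (s + 2) / (s + 1)\<^sup>2 > 0"
      using s \<open>r > 0\<close> by simp
    ultimately show False using q[of "- (r / (s + 1))"] by linarith
  qed
  then have "T v = m *\<^sub>R v" by (simp add: r_def w_def)
  with that vW nv show thesis by blast
qed

text \<open>The family is built one index at a time, hence the arbitrary set \<open>S\<close>. The
  orthogonal complement of the eigenvectors already found is invariant under \<open>H\<close>, and
  the next one is taken from it.\<close>

lemma hermitian_orthonormal_eigenvectors: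
  fixes H :: "'x::finite oper"
  assumes H: "dagger H = H"
  shows "\<exists>(u :: 'x \<Rightarrow> complex ^ 'x) d. (\<forall>i\<in>S. \<forall>j\<in>S. cinner (u i) (u j) = (if i = j then 1 else 0))
    \<and> (\<forall>i\<in>S. H *v u i = of_real (d i) *s u i)"
proof (use finite[of S] in \<open>induction S rule: finite_induct\<close>)
  case (insert k S)
  then obtain u :: "'x \<Rightarrow> complex ^ 'x" and d
    where orth: "\<And>i j. i \<in> S \<Longrightarrow> j \<in> S \<Longrightarrow> cinner (u i) (u j) = (if i = j then 1 else 0)"
      and eig: "\<And>i. i \<in> S \<Longrightarrow> H *v u i = of_real (d i) *s u i"
    by blast
  define W where "W = {w. \<forall>i\<in>S. cinner (u i) w = 0}"
  have W: "subspace W"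
  proof -
    have "cinner v (r *\<^sub>R w) = of_real r * cinner v w" for v w :: "complex ^ 'x" and r
      by (simp add: cinner_def sum_distrib_left scaleR_conv_of_real[where 'a=complex] mult_ac)
    then show ?thesis
      by (auto simp: subspace_def W_def cinner_add_right) (simp add: cinner_def)
  qed
  have HW: "H *v w \<in> W" if "w \<in> W" for w
  proof -
    have "cinner (u i) (H *v w) = 0" if "i \<in> S" for i
    proof -
      have "cinner (u i) (H *v w) = cinner (of_real (d i) *s u i) w"
        using that by (metis H cinner_adjoint eig)
      also have "\<dots> = cnj (of_real (d i) * cinner w (u i))"
        by (subst cinner_commute) (simp add: cinner_scale_right)
      also have "\<dots> = 0"
        using \<open>w \<in> W\<close> that by (subst cinner_commute) (simp add: W_def)
      finally show ?thesis .
    qed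
    then show ?thesis by (simp add: W_def)
  qed
  \<comment> \<open>The real span of \<open>?B\<close> is the complex span of the vectors found so
    far. Its real dimension is at most \<open>2 * card S\<close>, below that of the whole space, so
    some nonzero vector is orthogonal to it.\<close>
  let ?B = "u ` S \<union> (\<lambda>i. \<i> *s u i) ` S"
  have "card ?B \<le> card S + card S"
    by (rule order.trans[OF card_Un_le]) (intro add_mono card_image_le finite)
  moreover have "card S < CARD('x)"
    using insert by (intro psubset_card_mono) auto
  ultimately have "dim ?B < DIM(complex ^ 'x)"
    using dim_le_card'[of ?B] by simp
  then obtain w0 where "w0 \<noteq> 0" and w0: "\<And>y. y \<in> span ?B \<Longrightarrow> orthogonal w0 y"
    using orthogonal_to_subspace_exists by blast
  have "cinner (u i) w0 = 0" if "i \<in> S" for i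
  proof -
    have "u i \<bullet> w0 = 0" "(\<i> *s u i) \<bullet> w0 = 0"
      using that by (auto intro!: w0 span_base simp: orthogonal_def[symmetric] orthogonal_commute[of _ w0])
    then show ?thesis
      by (simp only: inner_eq_Re_cinner[of "u i"] inner_i_eq_Im_cinner complex_eq_iff zero_complex.sel)
  qed
  then have "w0 \<in> W" by (simp add: W_def)
  have sa: "(H *v x) \<bullet> y = x \<bullet> (H *v y)" for x y
    using cinner_adjoint[of H x y] by (simp add: H inner_eq_Re_cinner)
  have lin: "linear (\<lambda>v. H *v v)"
    by (intro linearI) (auto simp: vec_eq_iff matrix_vector_mult_def sum.distrib
        algebra_simps scaleR_conv_of_real[where 'a=complex] sum_distrib_left)
  obtain v m where v: "v \<in> W" "norm v = 1" "H *v v = m *\<^sub>R v"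
    using selfadjoint_eigenvector[OF lin sa W HW \<open>w0 \<in> W\<close> \<open>w0 \<noteq> 0\<close>] .
  have "cinner (u i) v = 0" "cinner v (u i) = 0" if "i \<in> S" for i
    using v(1) that cinner_commute[of v "u i"] by (auto simp: W_def)
  moreover have "cinner v v = 1" by (simp add: cinner_self v(2))
  moreover have "H *v v = of_real m *s v"
    by (simp add: v(3) vec_eq_iff scaleR_conv_of_real[where 'a=complex])
  ultimately have "(\<forall>i\<in>insert k S. \<forall>j\<in>insert k S.
      cinner ((u(k := v)) i) ((u(k := v)) j) = (if i = j then 1 else 0)) \<and>
    (\<forall>i\<in>insert k S. H *v (u(k := v)) i = of_real ((d(k := m)) i) *s (u(k := v)) i)"
    using orth eig insert by auto
  then show ?case by blast
qed simp

section \<open>Real diagonal matrices and the spectral theorem\<close>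

definition diag_op :: "('x::finite \<Rightarrow> real) \<Rightarrow> 'x oper" where
  "diag_op d = (\<chi> i j. if i = j then of_real (d i) else 0)"

lemma diag_op_mult: "diag_op d ** diag_op e = diag_op (\<lambda>i. d i * e i)"
  by (auto simp: vec_eq_iff diag_op_def matrix_matrix_mult_def if_distrib[of "\<lambda>x. x * _"] cong: if_cong)

lemma dagger_diag_op [simp]: "dagger (diag_op d) = diag_op d"
  by (auto simp: vec_eq_iff diag_op_def)

lemma trace_diag_op: "trace (diag_op d) = of_real (\<Sum>i\<in>UNIV. d i)"
  by (simp add: trace_def diag_op_def)

lemma diag_op_mult_left: "(diag_op d ** M) $ i $ j = of_real (d i) * M $ i $ j"
  by (simp add: diag_op_def matrix_matrix_mult_def if_distrib[of "\<lambda>x. x * _"] cong: if_cong)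

lemma diag_op_mult_right: "(M ** diag_op d) $ i $ j = M $ i $ j * of_real (d j)"
  by (simp add: diag_op_def matrix_matrix_mult_def if_distrib[of "\<lambda>x. _ * x"] cong: if_cong)

lemma positive_diag_op:
  assumes "\<And>i. d i \<ge> 0"
  shows "positive_op (diag_op d)"
proof -
  have [simp]: "z * (of_real r * cnj z) = of_real r * (of_real (cmod z))\<^sup>2" for z r
    using complex_norm_square[of z] by simp
  have "cinner v (diag_op d *v v) = of_real (\<Sum>i\<in>UNIV. d i * (cmod (v $ i))\<^sup>2)" for v
    by (simp add: cinner_def diag_op_def matrix_vector_mult_def if_distrib[of "\<lambda>x. _ * x"]
        if_distrib[of "\<lambda>x. x * _"] mult_ac cong: if_cong)
  then show ?thesis
    unfolding positive_op_def using assms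
    by (simp only: nonneg_Reals_of_real_iff sum_nonneg mult_nonneg_nonneg zero_le_power2 simp_thms)
qed

lemma unitary_opD:
  assumes "unitary_op U"
  shows "dagger U ** U = mat 1" "U ** dagger U = mat 1"
    "M ** dagger U ** U = M" "N ** U ** dagger U = N"
  using assms by (auto simp: unitary_op_def simp flip: matrix_mul_assoc)

lemma unitary_op_dagger: "unitary_op U \<Longrightarrow> unitary_op (dagger U)"
  by (simp add: unitary_op_def)

lemma hermitian_spectral:
  fixes H :: "'x::finite oper"
  assumes "dagger H = H"
  obtains U :: "'x oper" and d where "unitary_op U" "H = U ** diag_op d ** dagger U"
proof -
  obtain u :: "'x \<Rightarrow> complex ^ 'x" and d
    where orth: "\<And>i j. cinner (u i) (u j) = (if i = j then 1 else 0)"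
      and eig: "\<And>i. H *v u i = of_real (d i) *s u i"
    using hermitian_orthonormal_eigenvectors[OF assms, of UNIV] by auto
  define U :: "'x oper" where "U = (\<chi> i j. u j $ i)"
  have 1: "dagger U ** U = mat 1"
    using orth by (simp add: vec_eq_iff U_def matrix_matrix_mult_def mat_def cinner_def)
  then have 2: "unitary_op U"
    by (simp add: unitary_op_def matrix_left_right_inverse)
  have "(H ** U) $ i $ j = (H *v u j) $ i" for i j
    by (simp add: U_def matrix_matrix_mult_def matrix_vector_mult_def)
  then have "H ** U = U ** diag_op d"
    by (simp add: vec_eq_iff eig diag_op_mult_right) (simp add: U_def mult.commute)
  then have "H = U ** diag_op d ** dagger U"
    by (metis 2 unitary_opD(4))
  with 2 that show thesis by blast
qed

section \<open>Positive operators and their square roots\<close>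

lemma positive_opD: "positive_op M \<Longrightarrow> cinner v (M *v v) \<in> \<real>\<^sub>\<ge>\<^sub>0"
  by (simp add: positive_op_def)

lemma positive_op_add: "positive_op M \<Longrightarrow> positive_op N \<Longrightarrow> positive_op (M + N)"
  by (simp add: positive_op_def matrix_vector_mult_add_rdistrib cinner_add_right nonneg_Reals_add_I)

lemma positive_op_conj: "positive_op M \<Longrightarrow> positive_op (U ** M ** dagger U)"
  for U :: "complex ^ 'x::finite ^ 'y::finite"
  unfolding positive_op_def
  by (metis cinner_adjoint dagger_dagger matrix_vector_mul_assoc)

lemma positive_op_conj': "positive_op M \<Longrightarrow> positive_op (dagger U ** M ** U)"
  for U :: "complex ^ 'x::finite ^ 'y::finite"
  using positive_op_conj[of M "dagger U"] by simp

lemma cinner_axis: "cinner (axis k 1) w = w $ k"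
  by (simp add: cinner_def axis_def if_distrib[of "\<lambda>x. cnj x * _"] cong: if_cong)

lemma matrix_vector_axis: "(M *v axis k 1) $ i = M $ i $ k"
  for M :: "complex ^ 'x::finite ^ 'y"
  by (simp add: matrix_vector_mult_def axis_def if_distrib[of "\<lambda>x. _ * x"] cong: if_cong)

lemma positive_op_diagonal: "positive_op M \<Longrightarrow> M $ i $ i \<in> \<real>\<^sub>\<ge>\<^sub>0"
  using positive_opD[of M "axis i 1"] by (simp add: cinner_axis matrix_vector_axis)

text \<open>By polarisation; only the reality of the quadratic form is used.\<close>

lemma positive_op_hermitian:
  assumes "positive_op M"
  shows "dagger M = M"
proof -
  define v where "v c i j = axis i (1::complex) + c *s axis j 1" for c and i j :: 'a
  have v: "cinner (v c i j) w = w $ i + cnj c * w $ j" for c i j w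
  proof -
    have "cinner (v c i j) w = cnj (cinner w (v c i j))" by (rule cinner_commute)
    also have "\<dots> = cnj (cinner w (axis i 1)) + cnj c * cnj (cinner w (axis j 1))"
      by (simp add: v_def cinner_add_right cinner_scale_right)
    also have "\<dots> = w $ i + cnj c * w $ j"
      by (simp only: cinner_commute[symmetric] cinner_axis)
    finally show ?thesis .
  qed
  have "Im (cinner (v c i j) (M *v v c i j)) = 0" for c i j
    using positive_opD[OF assms] by (auto simp: complex_nonneg_Reals_iff)
  moreover have "cinner (v c i j) (M *v v c i j) =
    M $ i $ i + c * M $ i $ j + cnj c * (M $ j $ i + c * M $ j $ j)" for c i j
    unfolding v by (simp add: v_def matrix_vector_right_distrib vector_scalar_commute
        matrix_vector_axis)
  ultimately have
    im: "Im (M $ i $ i + c * M $ i $ j + cnj c * (M $ j $ i + c * M $ j $ j)) = 0" for c i j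
    by (simp only:)
  have diag: "Im (M $ i $ i) = 0" for i
    using positive_op_diagonal[OF assms] by (auto simp: complex_nonneg_Reals_iff)
  have e: "Im (M $ i $ j) + Im (M $ j $ i) = 0" "Re (M $ i $ j) - Re (M $ j $ i) = 0" for i j
    \<comment> \<open>With \<open>c = 1\<close> the imaginary parts of the two off-diagonal entries
      cancel; with \<open>c = \<i>\<close> their real parts agree.\<close>
    using im[of i 1 j] im[of i \<i> j] diag[of i] diag[of j]
    unfolding complex_cnj_i complex_cnj_one plus_complex.sel times_complex.sel uminus_complex.sel
      one_complex.sel imaginary_unit.sel
    by (simp_all only: mult_1 mult_zero_left mult_minus_left minus_zero)
  have "cnj (M $ j $ i) = M $ i $ j" for i j
    using e[of i j] by (intro complex_eqI) simp_all
  then show ?thesis by (simp add: vec_eq_iff)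
qed

lemma positive_op_spectral:
  fixes P :: "'x::finite oper"
  assumes "positive_op P"
  obtains U :: "'x oper" and d where "unitary_op U" "\<And>i. d i \<ge> 0" "P = U ** diag_op d ** dagger U"
proof -
  obtain U :: "'x oper" and d where U: "unitary_op U" and P: "P = U ** diag_op d ** dagger U"
    using hermitian_spectral[OF positive_op_hermitian[OF assms]] .
  have "dagger U ** P ** U = diag_op d"
    by (simp add: P matrix_mul_assoc unitary_opD[OF U])
  then have "diag_op d $ i $ i \<in> \<real>\<^sub>\<ge>\<^sub>0" for i
    using positive_op_diagonal[OF positive_op_conj'[OF assms]] by metis
  then have "d i \<ge> 0" for i
    by (simp add: diag_op_def)
  with U P that show thesis by blast
qed

text \<open>
  With spectral decompositions \<open>U D U\<^sup>\<dagger>\<close> and \<open>V E V\<^sup>\<dagger>\<close> of the two roots, \<open>W = U\<^sup>\<dagger> V\<close> intertwines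
  \<open>D\<^sup>2\<close> and \<open>E\<^sup>2\<close>, hence \<open>D\<close> and \<open>E\<close>.
\<close>

lemma positive_sqrt_unique:
  fixes P Q :: "'x::finite oper"
  assumes "positive_op P" "positive_op Q" and eq: "P ** P = Q ** Q"
  shows "P = Q"
proof -
  obtain U :: "'x oper" and d where U: "unitary_op U" and d: "\<And>i. d i \<ge> 0"
    and P: "P = U ** diag_op d ** dagger U"
    using positive_op_spectral[OF assms(1)] by blast
  obtain V :: "'x oper" and e where V: "unitary_op V" and e: "\<And>i. e i \<ge> 0"
    and Q: "Q = V ** diag_op e ** dagger V"
    using positive_op_spectral[OF assms(2)] by blast
  define W where "W = dagger U ** V"
  have "dagger U ** (P ** P) ** V = diag_op (\<lambda>i. d i * d i) ** W"
    by (simp add: P W_def matrix_mul_assoc unitary_opD[OF U] flip: diag_op_mult)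
  moreover have "dagger U ** (Q ** Q) ** V = W ** diag_op (\<lambda>i. e i * e i)"
    by (simp add: Q W_def matrix_mul_assoc unitary_opD[OF V] flip: diag_op_mult)
  ultimately have "diag_op (\<lambda>i. d i * d i) ** W = W ** diag_op (\<lambda>i. e i * e i)"
    by (simp only: eq)
  then have sq: "of_real (d i * d i) * W $ i $ j = W $ i $ j * of_real (e j * e j)" for i j
    using diag_op_mult_left[of "\<lambda>i. d i * d i" W i j] diag_op_mult_right[of W "\<lambda>i. e i * e i" i j]
    by (simp only:)
  \<comment> \<open>A nonzero entry of \<open>W\<close> forces equal squares of \<open>d i\<close>
    and \<open>e j\<close>, and both are nonnegative.\<close>
  have "of_real (d i) * W $ i $ j = W $ i $ j * of_real (e j)" for i j
  proof (cases "W $ i $ j = 0")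
    case False
    then have "complex_of_real (d i * d i) = of_real (e j * e j)"
      using sq[of i j] mult_left_cancel[OF False] by (simp only: mult.commute[of _ "W $ i $ j"])
    then have "(d i)\<^sup>2 = (e j)\<^sup>2" by (simp only: of_real_eq_iff power2_eq_square)
    then show ?thesis using d e by (simp add: power2_eq_iff_nonneg)
  qed simp
  then have "diag_op d ** W = W ** diag_op e"
    by (simp add: vec_eq_iff diag_op_mult_left diag_op_mult_right)
  then have "U ** (diag_op d ** W) ** dagger V = U ** (W ** diag_op e) ** dagger V"
    by simp
  then show ?thesis
    by (simp add: P Q W_def matrix_mul_assoc unitary_opD[OF U] unitary_opD[OF V])
qed

text \<open>Resolves the definite description in \<open>sqrt_op\<close>: any positive root that can
  be exhibited is the chosen one.\<close>

lemma sqrt_op_square: "positive_op P \<Longrightarrow> sqrt_op (P ** P) = P"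
  unfolding sqrt_op_def by (rule the_equality) (auto intro: positive_sqrt_unique)

section \<open>The trace norm of a Hermitian matrix\<close>

lemma trace_unitary_conj:
  fixes M :: "'x::finite oper" and U :: "complex ^ 'x ^ 'y::finite"
  assumes "unitary_op U"
  shows "trace (U ** M ** dagger U) = trace M"
proof -
  have "trace (U ** M ** dagger U) = trace (dagger U ** (U ** M))"
    unfolding trace_def matrix_matrix_mult_def
    by simp (subst sum.swap, simp add: mult.commute)
  then show ?thesis
    by (simp add: matrix_mul_assoc unitary_opD[OF assms])
qed

text \<open>The library norm on matrices is the Frobenius norm; written as a trace it is visibly
  invariant under unitary conjugation.\<close>

lemma norm_eq_trace: "(norm M)\<^sup>2 = Re (trace (dagger M ** M))"
  for M :: "'x::finite oper"
proof -
  have "(norm M)\<^sup>2 = (\<Sum>i\<in>UNIV. \<Sum>j\<in>UNIV. Re (cnj (M $ i $ j) * M $ i $ j))"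
    by (simp add: inner_vec_def inner_complex_def flip: dot_square_norm)
  also have "\<dots> = Re (trace (dagger M ** M))"
    unfolding trace_def matrix_matrix_mult_def by simp (rule sum.swap)
  finally show ?thesis .
qed

lemma norm_unitary_conj:
  fixes M :: "'x::finite oper" and U :: "complex ^ 'x ^ 'y::finite"
  assumes "unitary_op U"
  shows "norm (U ** M ** dagger U) = norm M"
proof -
  have "dagger (U ** M ** dagger U) ** (U ** M ** dagger U) = U ** (dagger M ** M) ** dagger U"
    by (simp add: dagger_matrix_mul matrix_mul_assoc unitary_opD[OF assms])
  then have "(norm (U ** M ** dagger U))\<^sup>2 = (norm M)\<^sup>2"
    by (simp add: norm_eq_trace trace_unitary_conj[OF assms])
  then show ?thesis by (simp add: power2_eq_iff_nonneg)
qed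

text \<open>Replacing the eigenvalues by their absolute values gives a positive root of the square,
  so its trace is the trace norm.\<close>

lemma trace_norm_spectral:
  fixes U :: "'x::finite oper"
  assumes U: "unitary_op U"
  shows "trace_norm (U ** diag_op d ** dagger U) = (\<Sum>i\<in>UNIV. \<bar>d i\<bar>)"
proof -
  let ?H = "U ** diag_op d ** dagger U" and ?R = "U ** diag_op (\<lambda>i. \<bar>d i\<bar>) ** dagger U"
  have "dagger ?H ** ?H = U ** (diag_op d ** diag_op d) ** dagger U"
    by (simp add: dagger_matrix_mul matrix_mul_assoc unitary_opD[OF U])
  also have "\<dots> = U ** (diag_op (\<lambda>i. \<bar>d i\<bar>) ** diag_op (\<lambda>i. \<bar>d i\<bar>)) ** dagger U"
    by (simp add: diag_op_mult)
  also have "\<dots> = ?R ** ?R"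
    by (simp add: matrix_mul_assoc unitary_opD[OF U])
  finally have "sqrt_op (dagger ?H ** ?H) = ?R"
    by (simp add: sqrt_op_square positive_op_conj positive_diag_op)
  then show ?thesis
    by (simp add: trace_norm_def trace_unitary_conj[OF U] trace_diag_op)
qed

lemma trace_norm_uminus: "trace_norm (- M) = trace_norm M"
proof -
  have "dagger (- M) ** (- M) = dagger M ** M"
    by (simp add: vec_eq_iff matrix_matrix_mult_def)
  then show ?thesis by (simp add: trace_norm_def)
qed

lemma norm_diag_op_component: "norm (diag_op d $ i) = \<bar>d i\<bar>"
  by (simp add: norm_vec_def L2_set_def diag_op_def if_distrib[of norm] if_distrib[of "\<lambda>x. x\<^sup>2"]
      cong: if_cong)

text \<open>The numbers \<open>d i\<close> are the singular values of \<open>M\<close>. The trace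
  norm is their l1 norm and the Frobenius norm their l2 norm, so comparing the two matrix norms
  becomes a comparison of vector norms.\<close>

lemma trace_norm_singular_values:
  fixes M :: "'x::finite oper"
  obtains d :: "'x \<Rightarrow> real" where "\<And>i. d i \<ge> 0" "trace_norm M = (\<Sum>i\<in>UNIV. d i)" "norm M = norm (diag_op d)"
proof -
  have "cinner v ((dagger M ** M) *v v) = of_real ((norm (M *v v))\<^sup>2)" for v
    using cinner_adjoint[of "dagger M" v "M *v v"]
    by (simp only: matrix_vector_mul_assoc[symmetric] cinner_self dagger_dagger)
  then have "positive_op (dagger M ** M)"
    unfolding positive_op_def by (simp only: nonneg_Reals_of_real_iff zero_le_power2 simp_thms)
  then obtain U :: "'x oper" and e
    where U: "unitary_op U" and e: "\<And>i. e i \<ge> 0" and MM: "dagger M ** M = U ** diag_op e ** dagger U"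
    using positive_op_spectral by blast
  define d where "d i = sqrt (e i)" for i
  define P where "P = U ** diag_op d ** dagger U"
  have P: "positive_op P"
    unfolding P_def d_def by (intro positive_op_conj positive_diag_op) (simp add: e)
  have PP: "P ** P = dagger M ** M"
    by (simp add: P_def MM matrix_mul_assoc unitary_opD[OF U])
      (simp add: d_def e diag_op_mult flip: matrix_mul_assoc)
  have "trace_norm M = (\<Sum>i\<in>UNIV. d i)"
    unfolding trace_norm_def PP[symmetric] sqrt_op_square[OF P]
    by (simp add: P_def trace_unitary_conj[OF U] trace_diag_op)
  moreover have "(norm M)\<^sup>2 = (norm P)\<^sup>2"
    by (simp add: norm_eq_trace positive_op_hermitian[OF P] PP)
  then have "norm M = norm (diag_op d)"
    by (simp add: power2_eq_iff_nonneg P_def norm_unitary_conj[OF U])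
  ultimately show thesis
    using that[of d] e by (simp add: d_def)
qed

lemma trace_norm_nonneg: "0 \<le> trace_norm M"
  by (rule trace_norm_singular_values[of M]) (simp add: sum_nonneg)

lemma norm_le_trace_norm: "norm M \<le> trace_norm M"
proof (rule trace_norm_singular_values[of M])
  fix d :: "'a \<Rightarrow> real"
  assume d: "\<And>i. d i \<ge> 0" "trace_norm M = (\<Sum>i\<in>UNIV. d i)" "norm M = norm (diag_op d)"
  have "norm (diag_op d) \<le> (\<Sum>i\<in>UNIV. norm (diag_op d $ i))"
    unfolding norm_vec_def[of "diag_op d"] by (rule L2_set_le_sum) simp
  then show ?thesis by (simp add: d norm_diag_op_component)
qed

lemma trace_norm_le_norm: "trace_norm M \<le> real CARD('x) * norm M"
  for M :: "'x::finite oper"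
proof (rule trace_norm_singular_values[of M])
  fix d :: "'x \<Rightarrow> real"
  assume d: "\<And>i. d i \<ge> 0" "trace_norm M = (\<Sum>i\<in>UNIV. d i)" "norm M = norm (diag_op d)"
  have "d i \<le> norm (diag_op d)" for i
    using Finite_Cartesian_Product.norm_nth_le[of "diag_op d" i] d(1) by (simp add: norm_diag_op_component)
  then have "(\<Sum>i\<in>UNIV. d i) \<le> real CARD('x) * norm (diag_op d)"
    by (intro sum_bounded_above[of UNIV, simplified])
  then show ?thesis by (simp add: d)
qed

text \<open>The positive and negative parts of \<open>H\<close>, cut out by the signs of the
  eigenvalues.\<close>

lemma trace_norm_decomposition:
  fixes H :: "'x::finite oper"
  assumes "dagger H = H"
  obtains P Q where "positive_op P" "positive_op Q" "H = P - Q"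
    "trace_norm H = Re (trace P) + Re (trace Q)"
proof -
  obtain U :: "'x oper" and d where U: "unitary_op U" and H: "H = U ** diag_op d ** dagger U"
    using hermitian_spectral[OF assms] .
  let ?P = "U ** diag_op (\<lambda>i. max (d i) 0) ** dagger U"
  let ?Q = "U ** diag_op (\<lambda>i. max (- d i) 0) ** dagger U"
  have "diag_op d = diag_op (\<lambda>i. max (d i) 0) - diag_op (\<lambda>i. max (- d i) 0)"
    by (auto simp: vec_eq_iff diag_op_def max_def)
  then have "H = ?P - ?Q"
    by (simp add: H vec_eq_iff matrix_matrix_mult_def sum_subtractf left_diff_distrib
        right_diff_distrib)
  moreover have "trace_norm H = Re (trace ?P) + Re (trace ?Q)"
    by (auto simp: H trace_norm_spectral[OF U] trace_unitary_conj[OF U] trace_diag_op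
        simp flip: sum.distrib intro!: sum.cong)
  ultimately show thesis
    by (rule that[rotated 2]) (simp_all add: positive_diag_op positive_op_conj)
qed

text \<open>In an eigenbasis of \<open>P - Q\<close>, each eigenvalue is a difference of nonnegative
  diagonal entries of \<open>P\<close> and \<open>Q\<close>, so its absolute value is at most their
  sum. Summing gives the two traces, which do not depend on the basis.\<close>

lemma trace_norm_diff_le:
  fixes P Q :: "'x::finite oper"
  assumes P: "positive_op P" and Q: "positive_op Q"
  shows "trace_norm (P - Q) \<le> Re (trace P) + Re (trace Q)"
proof -
  have "dagger (P - Q) = P - Q"
    using P Q by (simp add: dagger_diff positive_op_hermitian)
  then obtain U :: "'x oper" and d where U: "unitary_op U" and d: "P - Q = U ** diag_op d ** dagger U"
    using hermitian_spectral by blast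
  let ?P = "dagger U ** P ** U" and ?Q = "dagger U ** Q ** U"
  have "dagger U ** (P - Q) ** U = diag_op d"
    by (simp add: d matrix_mul_assoc unitary_opD[OF U])
  then have "?P - ?Q = diag_op d"
    by (simp add: vec_eq_iff matrix_matrix_mult_def sum_subtractf left_diff_distrib
        right_diff_distrib)
  then have "(?P - ?Q) $ i $ i = diag_op d $ i $ i" for i by simp
  then have "d i = Re (?P $ i $ i) - Re (?Q $ i $ i)" for i
    by (simp add: diag_op_def complex_eq_iff)
  moreover have "Re (?P $ i $ i) \<ge> 0" "Re (?Q $ i $ i) \<ge> 0" for i
    using positive_op_diagonal[OF positive_op_conj'[OF P]] positive_op_diagonal[OF positive_op_conj'[OF Q]]
    by (auto simp: complex_nonneg_Reals_iff)
  ultimately have "\<bar>d i\<bar> \<le> Re (?P $ i $ i) + Re (?Q $ i $ i)" for i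
    by (smt (verit))
  then have "trace_norm (P - Q) \<le> (\<Sum>i\<in>UNIV. Re (?P $ i $ i) + Re (?Q $ i $ i))"
    by (simp add: d trace_norm_spectral[OF U] sum_mono)
  also have "\<dots> = Re (trace ?P) + Re (trace ?Q)"
    by (simp add: trace_def sum.distrib)
  also have "\<dots> = Re (trace P) + Re (trace Q)"
    using trace_unitary_conj[OF unitary_op_dagger[OF U], of P]
      trace_unitary_conj[OF unitary_op_dagger[OF U], of Q] by simp
  finally show ?thesis .
qed

text \<open>Adding the positive and negative parts of \<open>H\<close> and \<open>K\<close> gives
  some decomposition of \<open>H + K\<close>, and every decomposition bounds the trace norm from
  above.\<close>

lemma trace_norm_triangle:
  fixes H K :: "'x::finite oper"
  assumes "dagger H = H" "dagger K = K"
  shows "trace_norm (H + K) \<le> trace_norm H + trace_norm K"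
proof -
  obtain P Q where P: "positive_op P" "positive_op Q" "H = P - Q"
    "trace_norm H = Re (trace P) + Re (trace Q)"
    using trace_norm_decomposition[OF assms(1)] .
  obtain P' Q' where P': "positive_op P'" "positive_op Q'" "K = P' - Q'"
    "trace_norm K = Re (trace P') + Re (trace Q')"
    using trace_norm_decomposition[OF assms(2)] .
  have "H + K = (P + P') - (Q + Q')" by (simp add: P(3) P'(3))
  then have "trace_norm (H + K) \<le> Re (trace (P + P')) + Re (trace (Q + Q'))"
    using P P' by (simp only: trace_norm_diff_le positive_op_add)
  then show ?thesis by (simp add: P(4) P'(4) trace_add)
qed

lemma norm_density_le:
  assumes "\<rho> \<in> density_ops"
  shows "norm \<rho> \<le> 1"
proof -
  have "positive_op (0 :: 'a oper)" and 0: "trace (0 :: 'a oper) = 0"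
    by (simp_all add: positive_op_def cinner_def trace_def)
  then have "trace_norm (\<rho> - 0) \<le> Re (trace \<rho>) + Re (trace (0 :: 'a oper))"
    using assms by (intro trace_norm_diff_le) (auto simp: density_ops_def)
  then show ?thesis
    using norm_le_trace_norm[of \<rho>] assms
    by (simp add: density_ops_def 0)
qed

section \<open>Channels and their tensor products\<close>

lemma vector_space_cscale: "vector_space (cscale :: complex \<Rightarrow> 'x::finite oper \<Rightarrow> 'x oper)"
  by unfold_locales (simp_all add: vec_eq_iff algebra_simps)

lemma linear_map_iff:
  "linear_map L \<longleftrightarrow>
    (\<forall>M N. L (M + N) = L M + L N) \<and> (\<forall>c M. L (cscale c M) = cscale c (L M))"
  unfolding linear_map_def Vector_Spaces.linear_iff by (simp add: vector_space_cscale)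

lemma linear_map_add: "linear_map L \<Longrightarrow> L (M + N) = L M + L N"
  by (simp add: linear_map_iff)

lemma linear_map_cscale: "linear_map L \<Longrightarrow> L (cscale c M) = cscale c (L M)"
  by (simp add: linear_map_iff)

lemma cscale_minus_one: "cscale (- 1) M = - M"
  by (simp add: vec_eq_iff)

lemma linear_map_diff: "linear_map L \<Longrightarrow> L (M - N) = L M - L N"
  using linear_map_add[of L M "cscale (- 1) N"] linear_map_cscale[of L "- 1" N]
  by (simp add: cscale_minus_one)

lemma linear_map_comp: "linear_map L \<Longrightarrow> linear_map K \<Longrightarrow> linear_map (L \<circ> K)"
  by (simp add: linear_map_iff)

lemma linear_map_minus: "linear_map L \<Longrightarrow> linear_map K \<Longrightarrow> linear_map (\<lambda>\<rho>. L \<rho> - K \<rho>)"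
  by (simp add: linear_map_iff) (simp add: vec_eq_iff algebra_simps)

lemma linear_map_id: "linear_map id"
  by (simp add: linear_map_iff)

section \<open>Blocks of composite operators and tensor products of maps\<close>

definition block :: "('x::finite \<times> 'y::finite) oper \<Rightarrow> 'x \<Rightarrow> 'x \<Rightarrow> 'y oper" where
  "block M p q = (\<chi> j l. M $ (p, j) $ (q, l))"

lemma block_nth [simp]: "block M p q $ j $ l = M $ (p, j) $ (q, l)"
  by (simp add: block_def)

lemma tensor_map_nth:
  "tensor_map L K M $ (p, r) $ (q, s) = (\<Sum>i\<in>UNIV. \<Sum>j\<in>UNIV. \<Sum>k\<in>UNIV. \<Sum>l\<in>UNIV.
     M $ (i, j) $ (k, l) * (L (matrix_unit i k) $ p $ q * K (matrix_unit j l) $ r $ s))"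
  by (simp only: tensor_map_def tensor_op_def cscale_def sum_component vec_lambda_beta
      case_prod_beta fst_conv snd_conv sum_UNIV_prod)

lemma linear_map_tensor_map: "linear_map (tensor_map L K)"
  by (auto simp: linear_map_iff vec_eq_iff tensor_map_nth sum.distrib distrib_right
      sum_distrib_left mult.assoc)

lemma matrix_unit_nth: "matrix_unit i k $ p $ q = (if p = i then if q = k then 1 else 0 else 0)"
  by (simp add: matrix_unit_def)

text \<open>Tensoring with the identity on the left applies \<open>K\<close> to every block. This
  matches the array encoding of ancillas in \<open>completely_positive\<close>.\<close>

lemma tensor_map_id_left_nth:
  assumes "linear_map K"
  shows "tensor_map id K M $ (p, r) $ (q, s) = K (block M p q) $ r $ s"
proof -
  have "tensor_map id K M $ (p, r) $ (q, s) = (\<Sum>i\<in>UNIV. if p = i then \<Sum>k\<in>UNIV. if q = k then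
      \<Sum>j\<in>UNIV. \<Sum>l\<in>UNIV. M $ (i, j) $ (k, l) * K (matrix_unit j l) $ r $ s else 0 else 0)"
    unfolding tensor_map_nth
    by (intro sum.cong refl, subst sum.swap)
      (auto simp: matrix_unit_nth intro!: sum.cong simp del: sum.delta sum.delta')
  then show ?thesis
    by (simp add: linear_map_matrix_units[OF assms, of "block M p q"])
qed

lemma block_tensor_map: "linear_map K \<Longrightarrow> block (tensor_map id K M) p q = K (block M p q)"
  by (simp add: vec_eq_iff tensor_map_id_left_nth)

lemma tensor_map_id_right_nth:
  "tensor_map L id M $ (p, r) $ (q, s) =
    (\<Sum>i\<in>UNIV. \<Sum>k\<in>UNIV. M $ (i, r) $ (k, s) * L (matrix_unit i k) $ p $ q)"
proof -
  have "tensor_map L id M $ (p, r) $ (q, s) = (\<Sum>i\<in>UNIV. \<Sum>j\<in>UNIV. if r = j then \<Sum>k\<in>UNIV.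
      \<Sum>l\<in>UNIV. if s = l then M $ (i, j) $ (k, l) * L (matrix_unit i k) $ p $ q else 0 else 0)"
    unfolding tensor_map_nth
    by (intro sum.cong refl)
      (auto simp: matrix_unit_nth intro!: sum.cong simp del: sum.delta sum.delta')
  then show ?thesis by simp
qed

text \<open>Together with \<open>tensor_map_id_right\<close>, which conjugates by the swap, this
  reduces every tensor product to the blockwise case with the identity on the left.\<close>

lemma tensor_map_factor:
  assumes "linear_map K"
  shows "tensor_map L K = tensor_map L id \<circ> tensor_map id K"
proof -
  have "tensor_map L K M $ (p, r) $ (q, s) = tensor_map L id (tensor_map id K M) $ (p, r) $ (q, s)"
    for M p r q s
  proof -
    have "tensor_map L id (tensor_map id K M) $ (p, r) $ (q, s) =
      (\<Sum>i\<in>UNIV. \<Sum>k\<in>UNIV. (\<Sum>j\<in>UNIV. \<Sum>l\<in>UNIV. M $ (i, j) $ (k, l) * K (matrix_unit j l) $ r $ s)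
        * L (matrix_unit i k) $ p $ q)"
      by (simp add: tensor_map_id_right_nth tensor_map_id_left_nth[OF assms]
          linear_map_matrix_units[OF assms, of "block M _ _"])
    also have "\<dots> = (\<Sum>i\<in>UNIV. \<Sum>k\<in>UNIV. \<Sum>j\<in>UNIV. \<Sum>l\<in>UNIV.
        M $ (i, j) $ (k, l) * (L (matrix_unit i k) $ p $ q * K (matrix_unit j l) $ r $ s))"
      by (simp add: sum_distrib_left sum_distrib_right mult_ac)
    also have "\<dots> = tensor_map L K M $ (p, r) $ (q, s)"
      unfolding tensor_map_nth by (intro sum.cong refl sum.swap)
    finally show ?thesis by simp
  qed
  then show ?thesis by (simp add: fun_eq_iff vec_eq_iff)
qed

lemma tensor_map_id_right:
  fixes L :: "'x::finite oper \<Rightarrow> 'y::finite oper"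
  assumes "linear_map L"
  shows "(tensor_map L id :: ('x \<times> 'z::finite) oper \<Rightarrow> _) =
    reindex prod.swap \<circ> tensor_map id L \<circ> reindex prod.swap"
proof -
  have "tensor_map L id M $ (p, r) $ (q, s) =
      (reindex prod.swap (tensor_map id L (reindex prod.swap M))) $ (p, r) $ (q, s)"
    for M :: "('x \<times> 'z) oper" and p r q s
    by (simp add: tensor_map_id_right_nth reindex_def tensor_map_id_left_nth[OF assms]
        linear_map_matrix_units[OF assms, of "block _ _ _"])
  then show ?thesis by (simp add: fun_eq_iff vec_eq_iff)
qed

section \<open>Complete positivity of tensor products\<close>

lemma sum_in_nonneg_Reals:
  "(\<And>x. x \<in> A \<Longrightarrow> f x \<in> \<real>\<^sub>\<ge>\<^sub>0) \<Longrightarrow> (\<Sum>x\<in>A. f x) \<in> \<real>\<^sub>\<ge>\<^sub>0"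
  for f :: "'i \<Rightarrow> complex"
  by (simp add: complex_nonneg_Reals_iff sum_nonneg)

text \<open>\<open>positive_block\<close> with an arbitrary finite index set, so that ancillas can be composed.\<close>

definition positive_family :: "'i set \<Rightarrow> ('i \<Rightarrow> 'i \<Rightarrow> 'x::finite oper) \<Rightarrow> bool" where
  "positive_family I M \<longleftrightarrow> (\<forall>v. (\<Sum>i\<in>I. \<Sum>j\<in>I. cinner (v i) (M i j *v v j)) \<in> \<real>\<^sub>\<ge>\<^sub>0)"

lemma positive_block_eq: "positive_block n = positive_family {..<n}"
  by (simp add: positive_block_def positive_family_def fun_eq_iff)

lemma positive_family_reindex:
  fixes h :: "'j \<Rightarrow> 'i" and M :: "'i \<Rightarrow> 'i \<Rightarrow> 'x::finite oper"
  assumes h: "bij_betw h J I"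
  shows "positive_family J (\<lambda>i j. M (h i) (h j)) \<longleftrightarrow> positive_family I M"
proof
  have eq: "(\<Sum>i\<in>I. \<Sum>j\<in>I. cinner (v i) (M i j *v v j)) =
      (\<Sum>i\<in>J. \<Sum>j\<in>J. cinner (v (h i)) (M (h i) (h j) *v v (h j)))" for v
    by (simp add: sum.reindex_bij_betw[OF h, symmetric])
  {
    assume "positive_family J (\<lambda>i j. M (h i) (h j))"
    from this[unfolded positive_family_def, THEN spec, of "\<lambda>i. v (h i)" for v]
    show "positive_family I M"
      unfolding positive_family_def eq by simp
  next
    assume M: "positive_family I M"
    show "positive_family J (\<lambda>i j. M (h i) (h j))"
      unfolding positive_family_def
    proof
      fix w :: "'j \<Rightarrow> complex ^ 'x"
      have "w i = (w \<circ> inv_into J h) (h i)" if "i \<in> J" for i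
        using h that by (simp add: bij_betw_def)
      then have "(\<Sum>i\<in>J. \<Sum>j\<in>J. cinner (w i) (M (h i) (h j) *v w j)) =
          (\<Sum>i\<in>I. \<Sum>j\<in>I. cinner ((w \<circ> inv_into J h) i) (M i j *v (w \<circ> inv_into J h) j))"
        unfolding eq by (intro sum.cong refl) metis
      then show "(\<Sum>i\<in>J. \<Sum>j\<in>J. cinner (w i) (M (h i) (h j) *v w j)) \<in> \<real>\<^sub>\<ge>\<^sub>0"
        using M unfolding positive_family_def by (simp only:)
    qed
  }
qed

lemma completely_positive_family:
  assumes "completely_positive L" "finite I" "positive_family I M"
  shows "positive_family I (\<lambda>i j. L (M i j))"
proof -
  obtain h where h: "bij_betw h {..<card I} I"
    using ex_bij_betw_nat_finite[OF assms(2)] by (auto simp: lessThan_atLeast0)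
  have "positive_family {..<card I} (\<lambda>i j. L (M (h i) (h j)))"
    using assms(1,3) positive_family_reindex[OF h, of M]
    by (simp add: completely_positive_def positive_block_eq)
  then show ?thesis
    using positive_family_reindex[OF h, of "\<lambda>i j. L (M i j)"] by simp
qed

lemma positive_op_family: "positive_op M \<longleftrightarrow> positive_family {()} (\<lambda>_ _. M)"
proof
  assume M: "positive_family {()} (\<lambda>_ _. M)"
  show "positive_op M"
    unfolding positive_op_def
  proof
    fix v show "cinner v (M *v v) \<in> \<real>\<^sub>\<ge>\<^sub>0"
      using M[unfolded positive_family_def, THEN spec[of _ "\<lambda>_. v"]] by simp
  qed
qed (simp add: positive_op_def positive_family_def)

lemma completely_positive_op: "completely_positive L \<Longrightarrow> positive_op M \<Longrightarrow> positive_op (L M)"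
  using completely_positive_family[of L "{()}" "\<lambda>_ _. M"] by (simp add: positive_op_family)

text \<open>Vectors on \<open>'x \<times> 'y\<close> indexed by \<open>I\<close> are the same data
  as vectors on \<open>'y\<close> indexed by \<open>I \<times> UNIV\<close>, and the two quadratic
  forms agree. This absorbs the first tensor factor into the ancilla.\<close>

lemma positive_family_block:
  fixes M :: "'i \<Rightarrow> 'i \<Rightarrow> ('x::finite \<times> 'y::finite) oper"
  shows "positive_family (I \<times> UNIV) (\<lambda>a b. block (M (fst a) (fst b)) (snd a) (snd b))
    \<longleftrightarrow> positive_family I M"
proof
  have eq: "(\<Sum>a\<in>I \<times> UNIV. \<Sum>b\<in>I \<times> UNIV.
        cinner (\<chi> y. v (fst a) $ (snd a, y))
          (block (M (fst a) (fst b)) (snd a) (snd b) *v (\<chi> y. v (fst b) $ (snd b, y)))) =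
      (\<Sum>i\<in>I. \<Sum>j\<in>I. cinner (v i) (M i j *v v j))" for v :: "'i \<Rightarrow> complex ^ ('x \<times> 'y)"
  proof -
    have iter: "sum f (I \<times> UNIV) = (\<Sum>i\<in>I. \<Sum>p\<in>UNIV. f (i, p))" for f :: "'i \<times> 'x \<Rightarrow> complex"
      by (simp add: sum.cartesian_product)
    have "(\<Sum>a\<in>I \<times> UNIV. \<Sum>b\<in>I \<times> UNIV.
        cinner (\<chi> y. v (fst a) $ (snd a, y))
          (block (M (fst a) (fst b)) (snd a) (snd b) *v (\<chi> y. v (fst b) $ (snd b, y)))) =
      (\<Sum>i\<in>I. \<Sum>p\<in>UNIV. \<Sum>j\<in>I. \<Sum>q\<in>UNIV. cinner (\<chi> y. v i $ (p, y))
          (block (M i j) p q *v (\<chi> y. v j $ (q, y))))"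
      by (simp only: iter fst_conv snd_conv)
    also have "\<dots> = (\<Sum>i\<in>I. \<Sum>j\<in>I. \<Sum>p\<in>UNIV. \<Sum>q\<in>UNIV. cinner (\<chi> y. v i $ (p, y))
          (block (M i j) p q *v (\<chi> y. v j $ (q, y))))"
      by (intro sum.cong refl sum.swap)
    also have "\<dots> = (\<Sum>i\<in>I. \<Sum>j\<in>I. cinner (v i) (M i j *v v j))"
    proof (intro sum.cong refl)
      fix i j
      have "(\<Sum>q\<in>UNIV. cinner (\<chi> y. v i $ (p, y)) (block (M i j) p q *v (\<chi> y. v j $ (q, y)))) =
        (\<Sum>y\<in>UNIV. cnj (v i $ (p, y)) * (\<Sum>q\<in>UNIV. \<Sum>z\<in>UNIV. M i j $ (p, y) $ (q, z) * v j $ (q, z)))"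
        for p
        unfolding cinner_def
        by (subst sum.swap) (simp add: matrix_vector_mult_def sum_distrib_left)
      then show "(\<Sum>p\<in>UNIV. \<Sum>q\<in>UNIV. cinner (\<chi> y. v i $ (p, y))
          (block (M i j) p q *v (\<chi> y. v j $ (q, y)))) = cinner (v i) (M i j *v v j)"
        by (simp add: cinner_def matrix_vector_mult_def sum_UNIV_prod)
    qed
    finally show ?thesis .
  qed
  {
    assume M: "positive_family (I \<times> UNIV) (\<lambda>a b. block (M (fst a) (fst b)) (snd a) (snd b))"
    show "positive_family I M"
      unfolding positive_family_def
    proof
      fix v
      show "(\<Sum>i\<in>I. \<Sum>j\<in>I. cinner (v i) (M i j *v v j)) \<in> \<real>\<^sub>\<ge>\<^sub>0"
        using M[unfolded positive_family_def, rule_format, of "\<lambda>a. \<chi> y. v (fst a) $ (snd a, y)"]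
        unfolding eq .
    qed
  next
    assume M: "positive_family I M"
    show "positive_family (I \<times> UNIV) (\<lambda>a b. block (M (fst a) (fst b)) (snd a) (snd b))"
      unfolding positive_family_def
    proof
      fix w :: "'i \<times> 'x \<Rightarrow> complex ^ 'y"
      have "w a = (\<chi> y. (\<lambda>i. \<chi> u. w (i, fst u) $ snd u) (fst a) $ (snd a, y))" for a
        by (simp add: vec_eq_iff)
      then have "(\<Sum>a\<in>I \<times> UNIV. \<Sum>b\<in>I \<times> UNIV.
        cinner (w a) (block (M (fst a) (fst b)) (snd a) (snd b) *v w b)) =
        (\<Sum>i\<in>I. \<Sum>j\<in>I. cinner (\<chi> u. w (i, fst u) $ snd u) (M i j *v (\<chi> u. w (j, fst u) $ snd u)))"
        by (subst eq[symmetric]) simp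
      then show "(\<Sum>a\<in>I \<times> UNIV. \<Sum>b\<in>I \<times> UNIV.
        cinner (w a) (block (M (fst a) (fst b)) (snd a) (snd b) *v w b)) \<in> \<real>\<^sub>\<ge>\<^sub>0"
        using M by (simp add: positive_family_def)
    qed
  }
qed

lemma channelsD:
  assumes "L \<in> channels"
  shows "linear_map L" "completely_positive L" "trace (L M) = trace M"
  using assms by (auto simp: channels_def trace_preserving_def)

lemma channels_comp: "L \<in> channels \<Longrightarrow> K \<in> channels \<Longrightarrow> L \<circ> K \<in> channels"
  by (auto simp: channels_def linear_map_comp completely_positive_def trace_preserving_def)

lemma channels_id: "id \<in> channels"
  by (auto simp: channels_def linear_map_id completely_positive_def trace_preserving_def)

lemma trace_blocks: "trace M = (\<Sum>p\<in>UNIV. trace (block M p p))"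
  by (simp add: trace_def sum_UNIV_prod)

text \<open>Once \<open>'z\<close> is absorbed into the ancilla, \<open>tensor_map id K\<close>
  merely applies \<open>K\<close> to the entries of a larger array, so complete positivity of
  \<open>K\<close> applies directly. The trace is a sum over the diagonal blocks.\<close>

lemma channels_tensor_map_id:
  fixes K :: "'x::finite oper \<Rightarrow> 'y::finite oper"
  assumes K: "K \<in> channels"
  shows "(tensor_map id K :: ('z::finite \<times> 'x) oper \<Rightarrow> ('z \<times> 'y) oper) \<in> channels"
proof -
  note lin = channelsD(1)[OF K]
  have "completely_positive (tensor_map id K :: ('z \<times> 'x) oper \<Rightarrow> ('z \<times> 'y) oper)"
    unfolding completely_positive_def positive_block_eq
  proof (intro allI impI)
    fix n :: nat and M :: "nat \<Rightarrow> nat \<Rightarrow> ('z \<times> 'x) oper"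
    assume "positive_family {..<n} M"
    then have "positive_family ({..<n} \<times> UNIV) (\<lambda>a b. block (M (fst a) (fst b)) (snd a) (snd b))"
      by (simp add: positive_family_block)
    from completely_positive_family[OF channelsD(2)[OF K] _ this]
    have "positive_family ({..<n} \<times> UNIV)
        (\<lambda>a b. block (tensor_map id K (M (fst a) (fst b))) (snd a) (snd b))"
      by (simp add: block_tensor_map[OF lin])
    then show "positive_family {..<n} (\<lambda>i j. tensor_map id K (M i j))"
      using positive_family_block[of "{..<n}" "\<lambda>i j. tensor_map id K (M i j)"] by simp
  qed
  moreover have "trace (tensor_map id K M) = trace M" for M :: "('z \<times> 'x) oper"
    by (simp add: trace_blocks[of M] trace_blocks[of "tensor_map id K M"]
        block_tensor_map[OF lin] channelsD(3)[OF K])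
  ultimately show ?thesis
    by (simp add: channels_def linear_map_tensor_map trace_preserving_def)
qed

lemma linear_map_conj: "linear_map (\<lambda>\<rho>. U ** \<rho> ** dagger U)"
  for U :: "complex ^ 'x::finite ^ 'y::finite"
  by (auto simp: linear_map_iff vec_eq_iff matrix_matrix_mult_def sum.distrib distrib_left
      distrib_right sum_distrib_left sum_distrib_right mult_ac)

lemma unitary_channels_subset_channels: "unitary_channels \<subseteq> channels"
proof
  fix \<U> :: "'x::finite oper \<Rightarrow> 'y::finite oper"
  assume "\<U> \<in> unitary_channels"
  then obtain U :: "complex ^ 'x ^ 'y" where U: "unitary_op U" and \<U>: "\<U> = (\<lambda>\<rho>. U ** \<rho> ** dagger U)"
    by (auto simp: unitary_channels_def)
  \<comment> \<open>Moving the unitary onto the test vectors turns the quadratic form of the image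
    into that of the original array.\<close>
  have "cinner v (\<U> M *v w) = cinner (dagger U *v v) (M *v (dagger U *v w))" for M v w
    by (simp add: \<U> cinner_adjoint matrix_vector_mul_assoc matrix_mul_assoc)
  then have "completely_positive \<U>"
    by (simp add: completely_positive_def positive_block_def)
  then show "\<U> \<in> channels"
    by (simp add: channels_def \<U> linear_map_conj trace_preserving_def trace_unitary_conj[OF U])
qed

text \<open>Relabelling the basis is conjugation by a permutation matrix. The swap and both
  reassociations are instances.\<close>

lemma unitary_channels_reindex:
  fixes f :: "'y::finite \<Rightarrow> 'x::finite"
  assumes "bij f"
  shows "reindex f \<in> unitary_channels"
proof -
  define U :: "complex ^ 'x ^ 'y" where "U = (\<chi> i j. if f i = j then 1 else 0)"
  have "reindex f M = U ** M ** dagger U" for M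
    by (simp add: reindex_def U_def vec_eq_iff matrix_matrix_mult_def
        if_distrib[of "\<lambda>x. x * _"] if_distrib[of "\<lambda>x. _ * x"] if_distrib[of cnj] cong: if_cong)
  moreover have "U ** dagger U = mat 1"
    using bij_is_inj[OF assms]
    by (auto simp: U_def vec_eq_iff matrix_matrix_mult_def mat_def inj_eq
        if_distrib[of "\<lambda>x. x * _"] if_distrib[of cnj] cong: if_cong)
  moreover have "dagger U ** U = mat 1"
  proof -
    have "(dagger U ** U) $ i $ j = (\<Sum>k\<in>UNIV. (\<lambda>a. if a = i then if a = j then 1 else 0 else 0) (f k))"
      for i j
      unfolding U_def matrix_matrix_mult_def by (auto intro!: sum.cong)
    also have "\<dots> i j = (\<Sum>a\<in>UNIV. if a = i then if a = j then 1 else 0 else 0)" for i j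
      by (rule sum.reindex_bij_betw[OF assms])
    finally show ?thesis by (simp add: vec_eq_iff mat_def)
  qed
  ultimately show ?thesis
    unfolding unitary_channels_def unitary_op_def by blast
qed

lemma channels_reindex: "bij f \<Longrightarrow> reindex f \<in> channels"
  using unitary_channels_reindex unitary_channels_subset_channels by blast

lemma channels_tensor_map:
  assumes "L \<in> channels" "K \<in> channels"
  shows "tensor_map L K \<in> channels"
  unfolding tensor_map_factor[OF channelsD(1)[OF assms(2)], of L]
    tensor_map_id_right[OF channelsD(1)[OF assms(1)]]
  by (intro channels_comp channels_tensor_map_id channels_reindex assms bij_swap)

lemma inv_unitary_channel:
  fixes U :: "complex ^ 'x::finite ^ 'y::finite"
  assumes "unitary_op U"
  shows "inv (\<lambda>\<rho>. U ** \<rho> ** dagger U) = (\<lambda>\<rho>. dagger U ** \<rho> ** U)"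
  by (rule inv_equality) (simp_all add: matrix_mul_assoc unitary_opD[OF assms])

lemma unitary_channels_inv:
  assumes "\<U> \<in> unitary_channels"
  shows "inv \<U> \<in> unitary_channels" "inv \<U> (\<U> M) = M" "\<U> (inv \<U> N) = N"
    "norm (\<U> M) = norm M" "norm (inv \<U> N) = norm N"
proof -
  obtain U where U: "unitary_op U" and \<U>: "\<U> = (\<lambda>\<rho>. U ** \<rho> ** dagger U)"
    using assms by (auto simp: unitary_channels_def)
  have inv: "inv \<U> = (\<lambda>\<rho>. dagger U ** \<rho> ** U)"
    by (simp add: \<U> inv_unitary_channel[OF U])
  show "inv \<U> \<in> unitary_channels"
    unfolding unitary_channels_def inv using unitary_op_dagger[OF U]
    by (auto intro!: exI[of _ "dagger U"])
  show "inv \<U> (\<U> M) = M" "\<U> (inv \<U> N) = N"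
    unfolding inv by (simp_all add: \<U> matrix_mul_assoc unitary_opD[OF U])
  show "norm (\<U> M) = norm M" by (simp add: \<U> norm_unitary_conj[OF U])
  show "norm (inv \<U> N) = norm N"
    using norm_unitary_conj[OF unitary_op_dagger[OF U], of N] by (simp add: inv)
qed

text \<open>The channel that discards its input and prepares the basis state \<open>k\<close>. It
  specialises to \<open>trace_map\<close> and shows that there is a channel between any two
  systems.\<close>

definition trace_replace :: "'y::finite \<Rightarrow> 'x::finite oper \<Rightarrow> 'y oper" where
  "trace_replace k M = cscale (trace M) (matrix_unit k k)"

lemma trace_map_eq: "trace_map = trace_replace ()"
  by (simp add: fun_eq_iff vec_eq_iff trace_map_def trace_replace_def matrix_unit_nth)

lemma channels_trace_replace: "trace_replace k \<in> channels"
proof -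
  have "completely_positive (trace_replace k :: 'a oper \<Rightarrow> 'b oper)"
    unfolding completely_positive_def positive_block_def
  proof (intro allI impI)
    fix n and M :: "nat \<Rightarrow> nat \<Rightarrow> 'a oper" and v :: "nat \<Rightarrow> complex ^ 'b"
    assume M: "\<forall>v. (\<Sum>i<n. \<Sum>j<n. cinner (v i) (M i j *v v j)) \<in> \<real>\<^sub>\<ge>\<^sub>0"
    \<comment> \<open>The Kraus operators are \<open>|k><a|\<close>; \<open>w a i\<close> is the
      adjoint of the one for \<open>a\<close> applied to \<open>v i\<close>.\<close>
    define w where "w a i = (v i $ k) *s axis a 1" for a :: 'a and i
    have w: "cinner (w a i) (M i j *v w a j) = cnj (v i $ k) * (v j $ k * M i j $ a $ a)" for a i j
    proof -
      have "cinner (w a i) x = cnj (v i $ k) * x $ a" for x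
        using cinner_commute[of "w a i" x] cinner_commute[of x "axis a 1"]
        by (simp add: w_def cinner_scale_right cinner_axis)
      then show ?thesis
        by (simp add: w_def vector_scalar_commute matrix_vector_axis)
    qed
    have "(\<Sum>i<n. \<Sum>j<n. cinner (v i) (trace_replace k (M i j) *v v j)) =
      (\<Sum>i<n. \<Sum>j<n. \<Sum>a\<in>UNIV. cinner (w a i) (M i j *v w a j))"
    proof (intro sum.cong refl)
      fix i j
      have "(trace_replace k (M i j) *v v j) $ b = (if b = k then trace (M i j) * v j $ k else 0)" for b
        by (simp add: trace_replace_def matrix_vector_mult_def matrix_unit_nth
            if_distrib[of "\<lambda>x. x * _"] if_distrib[of "\<lambda>x. _ * x"] cong: if_cong)
      then show "cinner (v i) (trace_replace k (M i j) *v v j) =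
        (\<Sum>a\<in>UNIV. cinner (w a i) (M i j *v w a j))"
        unfolding w
        by (simp add: cinner_def trace_def sum_distrib_left sum_distrib_right mult_ac
            if_distrib[of "\<lambda>x. _ * x"] cong: if_cong)
    qed
    also have "\<dots> = (\<Sum>a\<in>UNIV. \<Sum>i<n. \<Sum>j<n. cinner (w a i) (M i j *v w a j))"
      by (subst (2) sum.swap, subst sum.swap) simp
    also have "\<dots> \<in> \<real>\<^sub>\<ge>\<^sub>0"
      by (rule sum_in_nonneg_Reals, rule M[rule_format])
    finally show "(\<Sum>i<n. \<Sum>j<n. cinner (v i) (trace_replace k (M i j) *v v j)) \<in> \<real>\<^sub>\<ge>\<^sub>0" .
  qed
  moreover have "trace (matrix_unit k k) = 1"
    by (simp add: trace_def matrix_unit_nth)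
  then have "trace (trace_replace k M :: 'b oper) = trace M" for M :: "'a oper"
    by (simp add: trace_replace_def trace_def flip: sum_distrib_left)
  moreover have "linear_map (trace_replace k :: 'a oper \<Rightarrow> 'b oper)"
    by (simp add: linear_map_iff trace_replace_def trace_add)
      (simp add: vec_eq_iff trace_def sum_distrib_left sum_distrib_right mult_ac distrib_left)
  ultimately show ?thesis
    by (simp add: channels_def trace_preserving_def)
qed

lemma channels_trace_map: "trace_map \<in> channels"
  by (simp add: trace_map_eq channels_trace_replace)

lemma channels_nonempty: "(channels :: ('x::finite oper \<Rightarrow> 'y::finite oper) set) \<noteq> {}"
  using channels_trace_replace by blast

lemma channel_density: "L \<in> channels \<Longrightarrow> \<rho> \<in> density_ops \<Longrightarrow> L \<rho> \<in> density_ops"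
  by (simp add: density_ops_def channelsD completely_positive_op)

definition hermitian_preserving :: "('x::finite oper \<Rightarrow> 'y::finite oper) \<Rightarrow> bool" where
  "hermitian_preserving L \<longleftrightarrow> (\<forall>M. L (dagger M) = dagger (L M))"

lemma hermitian_preserving_minus:
  "hermitian_preserving L \<Longrightarrow> hermitian_preserving K \<Longrightarrow> hermitian_preserving (\<lambda>\<rho>. L \<rho> - K \<rho>)"
  by (simp add: hermitian_preserving_def dagger_diff)

text \<open>A Hermitian matrix is a difference of positive ones, and these have positive, hence
  Hermitian, images. A general matrix is \<open>H + \<i> K\<close> with \<open>H\<close> and
  \<open>K\<close> Hermitian.\<close>

lemma hermitian_preserving_channel:
  fixes L :: "'x::finite oper \<Rightarrow> 'y::finite oper"
  assumes L: "L \<in> channels"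
  shows "hermitian_preserving L"
proof -
  note lin = channelsD(1)[OF L]
  have herm: "dagger (L H) = L H" if H: "dagger H = H" for H
  proof -
    obtain P Q where PQ: "positive_op P" "positive_op Q" "H = P - Q"
      using trace_norm_decomposition[OF H] by blast
    then show ?thesis
      by (simp add: linear_map_diff[OF lin] dagger_diff positive_op_hermitian
          completely_positive_op channelsD(2)[OF L])
  qed
  have "L (dagger M) = dagger (L M)" for M
  proof -
    define H where "H = cscale (1/2) (M + dagger M)"
    define K where "K = cscale (\<i>/2) (dagger M - M)"
    have hk: "dagger H = H" "dagger K = K"
      by (simp_all add: H_def K_def dagger_cscale dagger_add dagger_diff add.commute)
        (simp add: vec_eq_iff algebra_simps)
    have M: "M = H + cscale \<i> K" and M': "dagger M = H - cscale \<i> K"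
      by (simp_all add: H_def K_def vec_eq_iff field_simps)
    have "L (dagger M) = L H - cscale \<i> (L K)"
      unfolding M' by (simp add: linear_map_diff[OF lin] linear_map_cscale[OF lin])
    also have "\<dots> = dagger (L H + cscale \<i> (L K))"
      using herm[OF hk(1)] herm[OF hk(2)]
      by (simp add: dagger_add dagger_cscale) (simp add: vec_eq_iff)
    also have "\<dots> = dagger (L M)"
      by (subst M) (simp add: linear_map_add[OF lin] linear_map_cscale[OF lin])
    finally show ?thesis .
  qed
  then show ?thesis by (simp add: hermitian_preserving_def)
qed

lemma hermitian_preserving_tensor_map_id:
  assumes "linear_map L" "hermitian_preserving L"
  shows "hermitian_preserving (tensor_map id L)"
proof -
  have "block (dagger M) p q = dagger (block M q p)" for M :: "('c \<times> 'a) oper" and p q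
    by (simp add: vec_eq_iff)
  then show ?thesis
    using assms(2)
    by (simp add: hermitian_preserving_def vec_eq_iff[of "tensor_map id L _"]
        vec_eq_iff[of "tensor_map id L _ $ _"] tensor_map_id_left_nth[OF assms(1)])
qed

section \<open>The diamond norm\<close>

lemma cmod_nth_le_norm: "cmod (M $ i $ j) \<le> norm M"
  for M :: "'x::finite oper"
  by (rule order.trans[OF Finite_Cartesian_Product.norm_nth_le Finite_Cartesian_Product.norm_nth_le])

lemma norm_le_of_nth_le:
  fixes M :: "'x::finite oper"
  assumes "\<And>i j. cmod (M $ i $ j) \<le> b"
  shows "norm M \<le> (real CARD('x))\<^sup>2 * b"
proof -
  have "norm M \<le> (\<Sum>i\<in>UNIV. norm (M $ i))"
    unfolding norm_vec_def[of M] by (rule L2_set_le_sum) simp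
  also have "\<dots> \<le> (\<Sum>i\<in>(UNIV :: 'x set). \<Sum>j\<in>(UNIV :: 'x set). b)"
  proof (rule sum_mono)
    fix i
    have "norm (M $ i) \<le> (\<Sum>j\<in>UNIV. cmod (M $ i $ j))"
      unfolding norm_vec_def by (rule L2_set_le_sum) simp
    also have "\<dots> \<le> (\<Sum>j\<in>(UNIV :: 'x set). b)"
      by (intro sum_mono assms)
    finally show "norm (M $ i) \<le> (\<Sum>j\<in>(UNIV :: 'x set). b)" .
  qed
  finally show ?thesis by (simp add: power2_eq_square mult.assoc)
qed

lemma linear_map_norm_bound:
  assumes "linear_map L"
  obtains c where "c \<ge> 0" "\<And>M. norm (L M) \<le> c * norm M"
proof -
  have scale: "r *\<^sub>R M = cscale (of_real r) M" for r and M :: "'z::finite oper"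
    by (simp add: vec_eq_iff scaleR_conv_of_real[where 'a=complex])
  have "linear L"
    by (intro linearI) (simp_all add: scale linear_map_add[OF assms] linear_map_cscale[OF assms])
  then show thesis
    using linear_bounded_pos that by (metis less_imp_le)
qed

text \<open>Each entry of the output is an entry of \<open>L\<close> on some block, and each entry
  of a block is an entry of \<open>M\<close>. The crude constants only count entries.\<close>

lemma norm_tensor_map_id_le:
  fixes L :: "'x::finite oper \<Rightarrow> 'y::finite oper" and M :: "('z::finite \<times> 'x) oper"
  assumes lin: "linear_map L" and c: "c \<ge> 0" "\<And>M. norm (L M) \<le> c * norm M"
  shows "norm (tensor_map id L M) \<le> (real CARD('z \<times> 'y))\<^sup>2 * (real CARD('x))\<^sup>2 * c * norm M"
proof -
  have "norm (tensor_map id L M) \<le> (real CARD('z \<times> 'y))\<^sup>2 * (c * ((real CARD('x))\<^sup>2 * norm M))"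
  proof (rule norm_le_of_nth_le)
    fix u v :: "'z \<times> 'y"
    obtain p r where u: "u = (p, r)" by fastforce
    obtain q s where v: "v = (q, s)" by fastforce
    have "cmod (tensor_map id L M $ u $ v) \<le> norm (L (block M p q))"
      by (simp add: u v tensor_map_id_left_nth[OF lin] cmod_nth_le_norm)
    also have "\<dots> \<le> c * norm (block M p q)" by (rule c)
    also have "\<dots> \<le> c * ((real CARD('x))\<^sup>2 * norm M)"
      by (intro mult_left_mono norm_le_of_nth_le c) (simp add: cmod_nth_le_norm)
    finally show "cmod (tensor_map id L M $ u $ v) \<le> c * ((real CARD('x))\<^sup>2 * norm M)" .
  qed
  then show ?thesis by (simp add: mult_ac)
qed

lemma hermitian_tensor_density:
  fixes L :: "'x::finite oper \<Rightarrow> 'y::finite oper" and \<rho> :: "('z::finite \<times> 'x) oper"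
  assumes "linear_map L" "hermitian_preserving L" "\<rho> \<in> density_ops"
  shows "dagger (tensor_map id L \<rho>) = tensor_map id L \<rho>"
proof -
  have "dagger \<rho> = \<rho>"
    using assms(3) by (simp add: density_ops_def positive_op_hermitian)
  then show ?thesis
    using hermitian_preserving_tensor_map_id[OF assms(1,2), unfolded hermitian_preserving_def,
        THEN spec, of \<rho>] by simp
qed

text \<open>The first factor passes from the trace norm to the Frobenius norm on the output; the
  others come from tensoring with the identity.\<close>

definition diamond_const :: "'x::finite itself \<Rightarrow> 'y::finite itself \<Rightarrow> real" where
  "diamond_const X Y =
    real CARD('x \<times> 'y) * ((real CARD('x \<times> 'y))\<^sup>2 * (real CARD('x))\<^sup>2)"

lemma trace_norm_tensor_le:
  fixes L :: "'x::finite oper \<Rightarrow> 'y::finite oper" and \<rho> :: "('x \<times> 'x) oper"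
  assumes L: "linear_map L" and c: "c \<ge> 0" "\<And>M. norm (L M) \<le> c * norm M" and \<rho>: "\<rho> \<in> density_ops"
  shows "trace_norm (tensor_map id L \<rho>) \<le> diamond_const TYPE('x) TYPE('y) * c"
proof -
  have "trace_norm (tensor_map id L \<rho>) \<le> real CARD('x \<times> 'y) * norm (tensor_map id L \<rho>)"
    by (rule trace_norm_le_norm)
  also have "\<dots> \<le> real CARD('x \<times> 'y) *
      ((real CARD('x \<times> 'y))\<^sup>2 * (real CARD('x))\<^sup>2 * c * norm \<rho>)"
    by (intro mult_left_mono norm_tensor_map_id_le L c) auto
  also have "\<dots> \<le> real CARD('x \<times> 'y) * ((real CARD('x \<times> 'y))\<^sup>2 * (real CARD('x))\<^sup>2 * c * 1)"
    using c by (intro mult_left_mono norm_density_le \<rho>) auto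
  finally show ?thesis by (simp add: diamond_const_def mult_ac)
qed

definition max_entangled :: "('x::finite \<times> 'x) oper" where
  "max_entangled = (\<chi> u v. if fst u = snd u \<and> fst v = snd v then 1 / of_nat CARD('x) else 0)"

lemma max_entangled_density: "(max_entangled :: ('x::finite \<times> 'x) oper) \<in> density_ops"
proof -
  have "cinner v (max_entangled *v v) \<in> \<real>\<^sub>\<ge>\<^sub>0" for v :: "complex ^ ('x \<times> 'x)"
  proof -
    let ?s = "\<Sum>i\<in>UNIV. v $ (i, i)"
    have "(max_entangled *v v) $ u = (if fst u = snd u then ?s / of_nat CARD('x) else 0)" for u
      by (simp add: max_entangled_def matrix_vector_mult_def sum_UNIV_prod sum_divide_distrib
          if_distrib[of "\<lambda>x. x * _"] cong: if_cong)
    \<comment> \<open>The state is a rank-one projector, so its form is a squared modulus divided by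
      the dimension.\<close>
    then have "cinner v (max_entangled *v v) = cnj ?s * (?s / of_nat CARD('x))"
      by (simp add: cinner_def sum_UNIV_prod sum_distrib_right sum_divide_distrib
          if_distrib[of "\<lambda>x. _ * x"] cong: if_cong)
    also have "\<dots> = of_real ((cmod ?s)\<^sup>2 / real CARD('x))"
      using complex_norm_square[of ?s] by (simp add: mult.commute)
    finally show ?thesis by (simp only: nonneg_Reals_of_real_iff) simp
  qed
  moreover have "trace (max_entangled :: ('x \<times> 'x) oper) = 1"
    by (simp add: trace_def max_entangled_def sum_UNIV_prod)
  ultimately show ?thesis by (simp add: density_ops_def positive_op_def)
qed

lemma block_max_entangled:
  "block (max_entangled :: ('x::finite \<times> 'x) oper) p q = cscale (1 / of_nat CARD('x)) (matrix_unit p q)"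
  by (auto simp: vec_eq_iff max_entangled_def matrix_unit_nth)

text \<open>
  No assumption on \<open>L\<close>: \<open>tensor_map id L\<close> only sees the values of \<open>L\<close> on matrix units and is
  always linear. The locale \<open>Metric_space\<close> asks for nonnegativity and symmetry of the distance on the
  whole type, hence for the diamond norm of arbitrary functions.
\<close>

lemma diamond_norm_bdd_above:
  fixes L :: "'x::finite oper \<Rightarrow> 'y::finite oper"
  shows "bdd_above ((\<lambda>\<rho>. trace_norm (tensor_map id L \<rho>)) ` (density_ops :: ('x \<times> 'x) oper set))"
proof -
  obtain c where c: "c \<ge> 0" "\<And>\<rho> :: ('x \<times> 'x) oper. norm (tensor_map id L \<rho>) \<le> c * norm \<rho>"
    using linear_map_norm_bound[OF linear_map_tensor_map] by blast
  show ?thesis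
  proof (rule bdd_aboveI2)
    fix \<rho> :: "('x \<times> 'x) oper"
    assume "\<rho> \<in> density_ops"
    then have "c * norm \<rho> \<le> c * 1"
      by (intro mult_left_mono norm_density_le c)
    then have "norm (tensor_map id L \<rho>) \<le> c"
      using c(2)[of \<rho>] by simp
    then show "trace_norm (tensor_map id L \<rho>) \<le> real CARD('x \<times> 'y) * c"
      by (intro order.trans[OF trace_norm_le_norm] mult_left_mono) auto
  qed
qed

lemma density_ops_nonempty: "(density_ops :: ('x::finite \<times> 'x) oper set) \<noteq> {}"
  using max_entangled_density by blast

lemma trace_norm_le_diamond_norm:
  fixes L :: "'x::finite oper \<Rightarrow> 'y::finite oper" and \<rho> :: "('x \<times> 'x) oper"
  assumes "\<rho> \<in> density_ops"
  shows "trace_norm (tensor_map id L \<rho>) \<le> diamond_norm L"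
  unfolding diamond_norm_def by (intro cSUP_upper diamond_norm_bdd_above assms)

lemma diamond_norm_le:
  fixes L :: "'x::finite oper \<Rightarrow> 'y::finite oper"
  assumes "\<And>\<rho> :: ('x \<times> 'x) oper. \<rho> \<in> density_ops \<Longrightarrow> trace_norm (tensor_map id L \<rho>) \<le> b"
  shows "diamond_norm L \<le> b"
  unfolding diamond_norm_def by (intro cSUP_least density_ops_nonempty assms)

lemma diamond_norm_nonneg: "0 \<le> diamond_norm L"
  by (rule order.trans[OF trace_norm_nonneg trace_norm_le_diamond_norm[OF max_entangled_density]])

lemma diamond_norm_le_of_norm_le:
  fixes L :: "'x::finite oper \<Rightarrow> 'y::finite oper"
  assumes "linear_map L" "c \<ge> 0" "\<And>M. norm (L M) \<le> c * norm M"
  shows "diamond_norm L \<le> diamond_const TYPE('x) TYPE('y) * c"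
  by (intro diamond_norm_le trace_norm_tensor_le assms)

text \<open>Evaluating on the maximally entangled state recovers the Choi matrix of \<open>L\<close>.\<close>

lemma norm_le_diamond_norm:
  fixes L :: "'x::finite oper \<Rightarrow> 'y::finite oper"
  assumes L: "linear_map L"
  shows "norm (L M) \<le> (real CARD('y))\<^sup>2 * real CARD('x) ^ 3 * diamond_norm L * norm M"
proof -
  let ?n = "real CARD('x)"
  let ?\<Omega> = "max_entangled :: ('x \<times> 'x) oper"
  have unit: "cmod (L (matrix_unit i k) $ p $ q) \<le> ?n * diamond_norm L" for i k p q
  proof -
    have "tensor_map id L ?\<Omega> $ (i, p) $ (k, q) = L (matrix_unit i k) $ p $ q / of_nat CARD('x)"
      by (simp add: tensor_map_id_left_nth[OF L] block_max_entangled linear_map_cscale[OF L])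
    then have "cmod (L (matrix_unit i k) $ p $ q) = ?n * cmod (tensor_map id L ?\<Omega> $ (i, p) $ (k, q))"
      by (simp add: norm_divide)
    also have "\<dots> \<le> ?n * diamond_norm L"
      by (intro mult_left_mono order.trans[OF cmod_nth_le_norm] order.trans[OF norm_le_trace_norm]
          trace_norm_le_diamond_norm max_entangled_density) simp
    finally show ?thesis .
  qed
  \<comment> \<open>One factor \<open>?n\<close> undoes the normalisation of the entangled state,
    \<open>?n * ?n\<close> counts the matrix units, and the squared output dimension passes from
    entries to the norm.\<close>
  have "norm (L M) \<le> (real CARD('y))\<^sup>2 * (?n * ?n * (norm M * (?n * diamond_norm L)))"
  proof (rule norm_le_of_nth_le)
    fix p q
    have "cmod (L M $ p $ q) \<le>
        (\<Sum>i\<in>UNIV. \<Sum>k\<in>UNIV. cmod (M $ i $ k) * cmod (L (matrix_unit i k) $ p $ q))"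
      unfolding linear_map_matrix_units[OF L, of M]
      by (intro order.trans[OF norm_sum] sum_mono) (simp add: norm_mult)
    also have "\<dots> \<le> (\<Sum>i\<in>(UNIV :: 'x set). \<Sum>k\<in>(UNIV :: 'x set). norm M * (?n * diamond_norm L))"
      by (intro sum_mono mult_mono cmod_nth_le_norm unit) auto
    finally show "cmod (L M $ p $ q) \<le> ?n * ?n * (norm M * (?n * diamond_norm L))"
      by (simp add: mult.assoc)
  qed
  then show ?thesis by (simp add: power3_eq_cube mult_ac)
qed

lemma tensor_map_id_add:
  assumes "linear_map L" "linear_map K" "linear_map N" "\<And>M. N M = L M + K M"
  shows "tensor_map id N \<rho> = tensor_map id L \<rho> + tensor_map id K \<rho>"
proof -
  have "tensor_map id N \<rho> $ (p, r) $ (q, s) = (tensor_map id L \<rho> + tensor_map id K \<rho>) $ (p, r) $ (q, s)"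
    for p q r s
    by (simp add: tensor_map_id_left_nth assms)
  then show ?thesis by (simp add: vec_eq_iff)
qed

lemma tensor_map_id_minus:
  "tensor_map id (\<lambda>M. L M - K M) \<rho> = tensor_map id L \<rho> - tensor_map id K \<rho>"
proof -
  have "tensor_map id (\<lambda>M. L M - K M) \<rho> $ (p, r) $ (q, s) =
      (tensor_map id L \<rho> - tensor_map id K \<rho>) $ (p, r) $ (q, s)" for p q r s
    by (simp add: tensor_map_nth right_diff_distrib sum_subtractf)
  then show ?thesis by (simp add: vec_eq_iff)
qed

text \<open>Preservation of Hermiticity makes both outputs on a density operator Hermitian, which is
  the case covered by \<open>trace_norm_triangle\<close>.\<close>

lemma diamond_norm_triangle:
  fixes L K N :: "'x::finite oper \<Rightarrow> 'y::finite oper"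
  assumes L: "linear_map L" "hermitian_preserving L"
    and K: "linear_map K" "hermitian_preserving K"
    and N: "linear_map N" "\<And>M. N M = L M + K M"
  shows "diamond_norm N \<le> diamond_norm L + diamond_norm K"
proof (rule diamond_norm_le)
  fix \<rho> :: "('x \<times> 'x) oper"
  assume \<rho>: "\<rho> \<in> density_ops"
  have "trace_norm (tensor_map id N \<rho>) \<le>
      trace_norm (tensor_map id L \<rho>) + trace_norm (tensor_map id K \<rho>)"
    unfolding tensor_map_id_add[OF L(1) K(1) N]
    by (intro trace_norm_triangle hermitian_tensor_density L K \<rho>)
  also have "\<dots> \<le> diamond_norm L + diamond_norm K"
    by (intro add_mono trace_norm_le_diamond_norm \<rho>)
  finally show "trace_norm (tensor_map id N \<rho>) \<le> diamond_norm L + diamond_norm K" .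
qed

section \<open>The diamond distance between channels\<close>

definition diamond_dist ::
  "('x::finite oper \<Rightarrow> 'y::finite oper) \<Rightarrow> ('x oper \<Rightarrow> 'y oper) \<Rightarrow> real" where
  "diamond_dist L K = diamond_norm (\<lambda>\<rho>. L \<rho> - K \<rho>)"

lemma channels_minus:
  assumes "L \<in> channels" "K \<in> channels"
  shows "linear_map (\<lambda>\<rho>. L \<rho> - K \<rho>)" "hermitian_preserving (\<lambda>\<rho>. L \<rho> - K \<rho>)"
  using assms
  by (simp_all add: linear_map_minus hermitian_preserving_minus channelsD hermitian_preserving_channel)

lemma diamond_dist_nonneg: "0 \<le> diamond_dist L K"
  by (simp add: diamond_dist_def diamond_norm_nonneg)

lemma diamond_dist_commute:
  fixes L K :: "'x::finite oper \<Rightarrow> 'y::finite oper"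
  shows "diamond_dist L K = diamond_dist K L"
proof -
  have "trace_norm (tensor_map id (\<lambda>M. L M - K M) \<rho>) = trace_norm (tensor_map id (\<lambda>M. K M - L M) \<rho>)"
    for \<rho> :: "('x \<times> 'x) oper"
    using trace_norm_uminus[of "tensor_map id (\<lambda>M. L M - K M) \<rho>"]
    by (simp add: tensor_map_id_minus)
  then show ?thesis by (simp add: diamond_dist_def diamond_norm_def)
qed

lemma diamond_dist_triangle:
  assumes "L \<in> channels" "K \<in> channels" "N \<in> channels"
  shows "diamond_dist L N \<le> diamond_dist L K + diamond_dist K N"
  unfolding diamond_dist_def
  by (rule diamond_norm_triangle) (simp_all add: channels_minus assms)

lemma diamond_dist_le_2:
  fixes L K :: "'x::finite oper \<Rightarrow> 'y::finite oper"
  assumes "L \<in> channels" "K \<in> channels"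
  shows "diamond_dist L K \<le> 2"
  unfolding diamond_dist_def
proof (rule diamond_norm_le)
  fix \<rho> :: "('x \<times> 'x) oper"
  assume "\<rho> \<in> density_ops"
  then have "tensor_map id L \<rho> \<in> density_ops" "tensor_map id K \<rho> \<in> density_ops"
    by (simp_all add: channel_density channels_tensor_map_id assms)
  then show "trace_norm (tensor_map id (\<lambda>M. L M - K M) \<rho>) \<le> 2"
    using trace_norm_diff_le[of "tensor_map id L \<rho>" "tensor_map id K \<rho>"] assms
    by (simp add: tensor_map_id_minus channelsD density_ops_def)
qed

lemma norm_diff_le_diamond_dist:
  fixes L K :: "'x::finite oper \<Rightarrow> 'y::finite oper"
  assumes "L \<in> channels" "K \<in> channels"
  shows "norm (L M - K M) \<le> (real CARD('y))\<^sup>2 * real CARD('x) ^ 3 * diamond_dist L K * norm M"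
  unfolding diamond_dist_def by (intro norm_le_diamond_norm channels_minus assms)

lemma diamond_dist_le_of_norm_le:
  fixes L K :: "'x::finite oper \<Rightarrow> 'y::finite oper"
  assumes "L \<in> channels" "K \<in> channels" "c \<ge> 0" "\<And>M. norm (L M - K M) \<le> c * norm M"
  shows "diamond_dist L K \<le> diamond_const TYPE('x) TYPE('y) * c"
  unfolding diamond_dist_def by (intro diamond_norm_le_of_norm_le channels_minus assms)

lemma Metric_space_unitary_channels:
  "Metric_space (unitary_channels :: ('x::finite oper \<Rightarrow> 'y::finite oper) set) diamond_dist"
proof
  fix L K N :: "'x oper \<Rightarrow> 'y oper"
  show "0 \<le> diamond_dist L K" by (rule diamond_dist_nonneg)
  show "diamond_dist L K = diamond_dist K L" by (rule diamond_dist_commute)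
  assume "L \<in> unitary_channels" "K \<in> unitary_channels"
  then have LK: "L \<in> channels" "K \<in> channels"
    using unitary_channels_subset_channels by blast+
  show "diamond_dist L K = 0 \<longleftrightarrow> L = K"
  proof
    \<comment> \<open>Definiteness: the diamond distance controls the Frobenius norm of every
      difference \<open>L M - K M\<close>.\<close>
    assume "diamond_dist L K = 0"
    then have "norm (L M - K M) \<le> 0" for M
      using norm_diff_le_diamond_dist[OF LK, of M] by simp
    then show "L = K" by (simp add: fun_eq_iff)
  next
    assume "L = K"
    then have "diamond_dist L K \<le> diamond_const TYPE('x) TYPE('y) * 0"
      by (intro diamond_dist_le_of_norm_le LK) auto
    then show "diamond_dist L K = 0"
      using diamond_dist_nonneg[of L K] by simp
  qed
  assume "N \<in> unitary_channels"
  then show "diamond_dist L N \<le> diamond_dist L K + diamond_dist K N"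
    using unitary_channels_subset_channels by (blast intro: diamond_dist_triangle LK)
qed

section \<open>Continuity of signalling and causal influence\<close>

text \<open>
  Both quantities have the form \<open>INF \<C>. diamond_dist (F \<U>) (G \<C>)\<close>, the distance of \<open>F \<U>\<close> to a fixed
  set of channels, which is 1-Lipschitz in \<open>F \<U>\<close>.
\<close>

lemma INF_diamond_dist_bounds:
  fixes G :: "('c::finite oper \<Rightarrow> 'd::finite oper) \<Rightarrow> 'x::finite oper \<Rightarrow> 'y::finite oper"
  assumes G: "\<And>\<C>. \<C> \<in> channels \<Longrightarrow> G \<C> \<in> channels" and L: "L \<in> channels"
  shows "(INF \<C>\<in>channels. diamond_dist L (G \<C>)) \<in> {0..2}"
proof -
  obtain \<C>0 :: "'c oper \<Rightarrow> 'd oper" where "\<C>0 \<in> channels"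
    using channels_nonempty by blast
  then have "(INF \<C>\<in>channels. diamond_dist L (G \<C>)) \<le> 2"
    by (intro cINF_lower2[where x = \<C>0] diamond_dist_le_2 bdd_belowI2[of _ 0] diamond_dist_nonneg G L)
  moreover have "0 \<le> (INF \<C>\<in>channels. diamond_dist L (G \<C>))"
    by (intro cINF_greatest channels_nonempty diamond_dist_nonneg)
  ultimately show ?thesis by simp
qed

lemma INF_diamond_dist_le:
  fixes G :: "('c::finite oper \<Rightarrow> 'd::finite oper) \<Rightarrow> 'x::finite oper \<Rightarrow> 'y::finite oper"
  assumes G: "\<And>\<C>. \<C> \<in> channels \<Longrightarrow> G \<C> \<in> channels" and L: "L \<in> channels" and K: "K \<in> channels"
  shows "(INF \<C>\<in>channels. diamond_dist L (G \<C>)) \<le>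
    diamond_dist L K + (INF \<C>\<in>channels. diamond_dist K (G \<C>))"
proof -
  have "(INF \<C>\<in>channels. diamond_dist L (G \<C>)) - diamond_dist L K \<le> (INF \<C>\<in>channels. diamond_dist K (G \<C>))"
  proof (rule cINF_greatest[OF channels_nonempty])
    fix \<C> :: "'c oper \<Rightarrow> 'd oper"
    assume \<C>: "\<C> \<in> channels"
    have "(INF \<C>\<in>channels. diamond_dist L (G \<C>)) \<le> diamond_dist L (G \<C>)"
      by (intro cINF_lower \<C> bdd_belowI2[of _ 0] diamond_dist_nonneg)
    also have "\<dots> \<le> diamond_dist L K + diamond_dist K (G \<C>)"
      by (intro diamond_dist_triangle L K G \<C>)
    finally show "(INF \<C>\<in>channels. diamond_dist L (G \<C>)) - diamond_dist L K \<le> diamond_dist K (G \<C>)"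
      by simp
  qed
  then show ?thesis by simp
qed

text \<open>The condition on \<open>F\<close> is phrased with Frobenius norms, where it is easy to
  check. The conversions from and to the diamond distance happen once, inside this proof.\<close>

lemma continuous_map_INF_diamond_dist:
  fixes G :: "('c::finite oper \<Rightarrow> 'd::finite oper) \<Rightarrow> 'x::finite oper \<Rightarrow> 'y::finite oper"
    and F :: "('u::finite oper \<Rightarrow> 'v::finite oper) \<Rightarrow> 'x oper \<Rightarrow> 'y oper"
  assumes G: "\<And>\<C>. \<C> \<in> channels \<Longrightarrow> G \<C> \<in> channels"
    and F: "\<And>\<U>. \<U> \<in> unitary_channels \<Longrightarrow> F \<U> \<in> channels"
    and B: "B \<ge> 0" "\<And>\<U> \<V> M \<delta>. \<U> \<in> unitary_channels \<Longrightarrow> \<V> \<in> unitary_channels \<Longrightarrow> \<delta> \<ge> 0 \<Longrightarrow>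
      (\<And>N. norm (\<U> N - \<V> N) \<le> \<delta> * norm N) \<Longrightarrow> norm (F \<U> M - F \<V> M) \<le> B * \<delta> * norm M"
  shows "continuous_map unitary_topology (top_of_set {0..2})
    (\<lambda>\<U>. INF \<C>\<in>channels. diamond_dist (F \<U>) (G \<C>))"
proof -
  let ?f = "\<lambda>\<U>. INF \<C>\<in>channels. diamond_dist (F \<U>) (G \<C>)"
  \<comment> \<open>\<open>c\<close> bounds Frobenius differences by the diamond distance;
    \<open>A\<close> is the resulting Lipschitz constant of the infimum.\<close>
  define c where "c = (real CARD('v))\<^sup>2 * real CARD('u) ^ 3"
  define A where "A = diamond_const TYPE('x) TYPE('y) * (B * c)"
  have c: "c \<ge> 0" by (simp add: c_def)
  have A: "A \<ge> 0" using B by (simp add: A_def c_def diamond_const_def)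
  have one: "?f \<U> \<le> ?f \<V> + A * diamond_dist \<U> \<V>"
    if "\<U> \<in> unitary_channels" "\<V> \<in> unitary_channels" for \<U> \<V>
  proof -
    have ch: "\<U> \<in> channels" "\<V> \<in> channels"
      using that unitary_channels_subset_channels by blast+
    have le: "norm (\<U> N - \<V> N) \<le> c * diamond_dist \<U> \<V> * norm N" for N
      using norm_diff_le_diamond_dist[OF ch, of N] by (simp add: c_def)
    have F_le: "norm (F \<U> M - F \<V> M) \<le> B * (c * diamond_dist \<U> \<V>) * norm M" for M
      by (rule B(2)[OF that _ le]) (intro mult_nonneg_nonneg c diamond_dist_nonneg)
    have "diamond_dist (F \<U>) (F \<V>) \<le> diamond_const TYPE('x) TYPE('y) * (B * (c * diamond_dist \<U> \<V>))"
      by (intro diamond_dist_le_of_norm_le F_le F that mult_nonneg_nonneg B c diamond_dist_nonneg)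
    then show ?thesis
      using INF_diamond_dist_le[of G "F \<U>" "F \<V>", OF G F F] that by (simp add: A_def mult.assoc)
  qed
  have lip: "\<bar>?f \<U> - ?f \<V>\<bar> \<le> A * diamond_dist \<U> \<V>"
    if "\<U> \<in> unitary_channels" "\<V> \<in> unitary_channels" for \<U> \<V>
    using one[OF that] one[OF that(2,1)] by (simp add: diamond_dist_commute[of \<V>])
  interpret MS: Metric_space "unitary_channels :: ('u oper \<Rightarrow> 'v oper) set" diamond_dist
    by (rule Metric_space_unitary_channels)
  have top: "unitary_topology = MS.mtopology"
    by (simp add: unitary_topology_def diamond_dist_def[abs_def])
  have "continuous_map MS.mtopology euclidean ?f"
    unfolding mtopology_is_euclidean[symmetric] MS.metric_continuous_map[OF Met_TC.Metric_space_axioms]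
  proof (intro conjI ballI allI impI)
    fix \<U> and \<epsilon> :: real
    assume \<U>: "\<U> \<in> (unitary_channels :: ('u oper \<Rightarrow> 'v oper) set)" and \<epsilon>: "\<epsilon> > 0"
    \<comment> \<open>Dividing by \<open>A + 1\<close> keeps the radius meaningful when
      \<open>A = 0\<close>.\<close>
    have "dist (?f \<U>) (?f \<V>) < \<epsilon>"
      if \<V>: "\<V> \<in> unitary_channels" "diamond_dist \<U> \<V> < \<epsilon> / (A + 1)" for \<V>
    proof -
      have "dist (?f \<U>) (?f \<V>) \<le> A * diamond_dist \<U> \<V>"
        unfolding dist_real_def by (rule lip[OF \<U> \<V>(1)])
      also have "\<dots> \<le> (A + 1) * diamond_dist \<U> \<V>"
        by (intro mult_right_mono diamond_dist_nonneg) simp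
      also have "\<dots> < \<epsilon>"
        using \<V>(2) A by (simp add: field_simps)
      finally show ?thesis .
    qed
    then show "\<exists>\<delta>>0. \<forall>\<V>. \<V> \<in> unitary_channels \<and> diamond_dist \<U> \<V> < \<delta> \<longrightarrow> dist (?f \<U>) (?f \<V>) < \<epsilon>"
      using \<epsilon> A by (intro exI[of _ "\<epsilon> / (A + 1)"]) simp
  qed simp
  moreover have "?f \<U> \<in> {0..2}" if "\<U> \<in> unitary_channels" for \<U>
    by (rule INF_diamond_dist_bounds[of G "F \<U>", OF G F[OF that]])
  ultimately show ?thesis
    by (simp add: top continuous_map_in_subtopology image_subset_iff flip: image_subset_iff_funcset
        del: atLeastAtMost_iff)
qed

text \<open>Here \<open>F\<close> composes with the fixed partial trace \<open>?D\<close>, so a norm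
  bound of \<open>?D\<close> serves as the Lipschitz constant.\<close>

lemma signalling_continuous:
  "continuous_map (unitary_topology ::
       (('a::finite \<times> 'b::finite) oper \<Rightarrow> ('a'::finite \<times> 'b'::finite) oper) topology)
     (top_of_set {0..2}) signalling"
proof -
  let ?D = "tensor_map trace_map id :: ('a' \<times> 'b') oper \<Rightarrow> (unit \<times> 'b') oper"
  have D: "?D \<in> channels"
    by (intro channels_tensor_map channels_trace_map channels_id)
  obtain c where c: "c \<ge> 0" "\<And>M. norm (?D M) \<le> c * norm M"
    using linear_map_norm_bound[OF channelsD(1)[OF D]] by blast
  have "continuous_map unitary_topology (top_of_set {0..2})
    (\<lambda>\<U> :: ('a \<times> 'b) oper \<Rightarrow> ('a' \<times> 'b') oper.
      INF \<C>\<in>channels. diamond_dist (?D \<circ> \<U>) (tensor_map trace_map \<C>))"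
  proof (rule continuous_map_INF_diamond_dist)
    fix \<C> :: "'b oper \<Rightarrow> 'b' oper"
    assume "\<C> \<in> channels"
    then show "(tensor_map trace_map \<C> :: ('a \<times> 'b) oper \<Rightarrow> (unit \<times> 'b') oper) \<in> channels"
      by (intro channels_tensor_map channels_trace_map)
  next
    fix \<U> :: "('a \<times> 'b) oper \<Rightarrow> ('a' \<times> 'b') oper"
    assume "\<U> \<in> unitary_channels"
    then show "?D \<circ> \<U> \<in> channels"
      using unitary_channels_subset_channels by (blast intro: channels_comp D)
  next
    show "c \<ge> 0" by fact
  next
    fix \<U> \<V> :: "('a \<times> 'b) oper \<Rightarrow> ('a' \<times> 'b') oper" and M \<delta>
    assume \<delta>: "\<And>N. norm (\<U> N - \<V> N) \<le> \<delta> * norm N"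
    have "norm ((?D \<circ> \<U>) M - (?D \<circ> \<V>) M) = norm (?D (\<U> M - \<V> M))"
      by (simp add: linear_map_diff[OF channelsD(1)[OF D]])
    also have "\<dots> \<le> c * (\<delta> * norm M)"
      by (intro order.trans[OF c(2)] mult_left_mono c(1) \<delta>)
    finally show "norm ((?D \<circ> \<U>) M - (?D \<circ> \<V>) M) \<le> c * \<delta> * norm M"
      by (simp add: mult.assoc)
  qed
  then show ?thesis
    by (simp add: signalling_def[abs_def] diamond_dist_def)
qed

lemma channels_assoc_right: "assoc_right \<in> channels"
  unfolding assoc_right_def
  by (intro channels_reindex o_bij[of "\<lambda>((i, j), k). (i, (j, k))"]) (auto simp: fun_eq_iff)

lemma channels_assoc_left: "assoc_left \<in> channels"
  unfolding assoc_left_def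
  by (intro channels_reindex o_bij[of "\<lambda>(i, (j, k)). ((i, j), k)"]) (auto simp: fun_eq_iff)

lemma causal_influence_continuous:
  "continuous_map (unitary_topology ::
       (('a::finite \<times> 'b::finite) oper \<Rightarrow> ('a'::finite \<times> 'b'::finite) oper) topology)
     (top_of_set {0..2}) causal_influence"
proof -
  define S :: "('a \<times> ('a \<times> 'b)) oper \<Rightarrow> ('a \<times> ('a \<times> 'b)) oper"
    where "S = assoc_right \<circ> tensor_map swap_map id \<circ> assoc_left"
  have S: "S \<in> channels"
    unfolding S_def swap_map_def
    by (intro channels_comp channels_tensor_map channels_reindex channels_id channels_assoc_left
        channels_assoc_right bij_swap)
  obtain s where s: "s \<ge> 0" "\<And>M. norm (S M) \<le> s * norm M"
    using linear_map_norm_bound[OF channelsD(1)[OF S]] by blast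
  \<comment> \<open>\<open>k\<close> and \<open>k'\<close> bound the cost of tensoring with the
    identity on \<open>'a\<close>, for maps in the direction of \<open>\<U>\<close> and of its
    inverse respectively.\<close>
  define k where "k = (real CARD('a \<times> ('a' \<times> 'b')))\<^sup>2 * (real CARD('a \<times> 'b))\<^sup>2"
  define k' where "k' = (real CARD('a \<times> ('a \<times> 'b)))\<^sup>2 * (real CARD('a' \<times> 'b'))\<^sup>2"
  have k: "norm (tensor_map id L M) \<le> k * \<delta> * norm M"
    if "linear_map L" "\<delta> \<ge> 0" "\<And>N. norm (L N) \<le> \<delta> * norm N"
    for L :: "('a \<times> 'b) oper \<Rightarrow> ('a' \<times> 'b') oper" and M :: "('a \<times> ('a \<times> 'b)) oper" and \<delta>
    using norm_tensor_map_id_le[OF that, of M] by (simp add: k_def)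
  have k': "norm (tensor_map id L M) \<le> k' * \<delta> * norm M"
    if "linear_map L" "\<delta> \<ge> 0" "\<And>N. norm (L N) \<le> \<delta> * norm N"
    for L :: "('a' \<times> 'b') oper \<Rightarrow> ('a \<times> 'b) oper" and M :: "('a \<times> ('a' \<times> 'b')) oper" and \<delta>
    using norm_tensor_map_id_le[OF that, of M] by (simp add: k'_def)
  have nonneg: "k \<ge> 0" "k' \<ge> 0" by (simp_all add: k_def k'_def)
  have T: "T_map \<U> = tensor_map id \<U> \<circ> S \<circ> tensor_map id (inv \<U>)"
    for \<U> :: "('a \<times> 'b) oper \<Rightarrow> ('a' \<times> 'b') oper"
    by (simp add: T_map_def S_def comp_assoc)
  have "continuous_map unitary_topology (top_of_set {0..2})
    (\<lambda>\<U> :: ('a \<times> 'b) oper \<Rightarrow> ('a' \<times> 'b') oper.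
      INF \<C>\<in>channels. diamond_dist (T_map \<U>) (assoc_right \<circ> tensor_map \<C> id \<circ> assoc_left))"
  proof (rule continuous_map_INF_diamond_dist)
    fix \<C> :: "('a \<times> 'a') oper \<Rightarrow> ('a \<times> 'a') oper"
    assume "\<C> \<in> channels"
    then show "(assoc_right \<circ> tensor_map \<C> id \<circ> assoc_left :: ('a \<times> 'a' \<times> 'b') oper \<Rightarrow> _) \<in> channels"
      by (intro channels_comp channels_tensor_map channels_id channels_assoc_left channels_assoc_right)
  next
    fix \<U> :: "('a \<times> 'b) oper \<Rightarrow> ('a' \<times> 'b') oper"
    assume "\<U> \<in> unitary_channels"
    then have "\<U> \<in> channels" "inv \<U> \<in> channels"
      using unitary_channels_subset_channels unitary_channels_inv(1) by blast+
    then show "T_map \<U> \<in> channels"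
      unfolding T by (intro channels_comp channels_tensor_map_id S)
  next
    show "2 * k * s * k' \<ge> 0" by (simp add: nonneg s)
  next
    fix \<U> \<V> :: "('a \<times> 'b) oper \<Rightarrow> ('a' \<times> 'b') oper" and M :: "('a \<times> ('a' \<times> 'b')) oper" and \<delta> :: real
    assume \<U>: "\<U> \<in> unitary_channels" and \<V>: "\<V> \<in> unitary_channels" and "\<delta> \<ge> 0"
      and \<delta>: "\<And>N. norm (\<U> N - \<V> N) \<le> \<delta> * norm N"
    have ch: "\<U> \<in> channels" "\<V> \<in> channels" "inv \<U> \<in> channels" "inv \<V> \<in> channels"
      using \<U> \<V> unitary_channels_subset_channels unitary_channels_inv(1) by blast+
    note lin = ch[THEN channelsD(1)]
    have inv_diff: "norm (inv \<U> N - inv \<V> N) \<le> \<delta> * norm N" for N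
    proof -
      \<comment> \<open>Both inverses are isometric, so the difference of the inverses inherits the
        bound \<open>\<delta>\<close> without loss.\<close>
      have "inv \<U> N - inv \<V> N = inv \<U> (\<V> (inv \<V> N) - \<U> (inv \<V> N))"
        by (simp add: linear_map_diff[OF lin(3)] unitary_channels_inv[OF \<U>] unitary_channels_inv[OF \<V>])
      then have "norm (inv \<U> N - inv \<V> N) = norm (\<U> (inv \<V> N) - \<V> (inv \<V> N))"
        by (simp only: unitary_channels_inv(5)[OF \<U>] norm_minus_commute)
      also have "\<dots> \<le> \<delta> * norm (inv \<V> N)" by (rule \<delta>)
      finally show ?thesis by (simp add: unitary_channels_inv(5)[OF \<V>])
    qed
    let ?X = "tensor_map id (inv \<U>) M" and ?Y = "tensor_map id (inv \<V>) M"
    have X: "norm ?X \<le> k' * norm M"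
      using k'[OF lin(3), of 1 M] by (simp add: unitary_channels_inv(5)[OF \<U>])
    have XY: "norm (?X - ?Y) \<le> k' * \<delta> * norm M"
      using k'[OF linear_map_minus[OF lin(3,4)] \<open>\<delta> \<ge> 0\<close> inv_diff, of M] by (simp only: tensor_map_id_minus)
    \<comment> \<open>Telescoping: first the outer unitary is exchanged, then the inner inverse.
      Each term is at most \<open>k * s * k' * \<delta> * norm M\<close>, hence the factor 2 in the
      constant.\<close>
    have "T_map \<U> M - T_map \<V> M =
        tensor_map id (\<lambda>N. \<U> N - \<V> N) (S ?X) + tensor_map id \<V> (S (?X - ?Y))"
      by (simp add: T tensor_map_id_minus linear_map_diff[OF channelsD(1)[OF S]]
          linear_map_diff[OF linear_map_tensor_map])
    also have "norm \<dots> \<le> k * \<delta> * norm (S ?X) + k * 1 * norm (S (?X - ?Y))"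
      by (intro order.trans[OF norm_triangle_ineq] add_mono k linear_map_minus lin \<delta> \<open>\<delta> \<ge> 0\<close>)
        (simp_all add: unitary_channels_inv(4)[OF \<V>])
    also have "\<dots> \<le> k * \<delta> * (s * (k' * norm M)) + k * 1 * (s * (k' * \<delta> * norm M))"
      using \<open>\<delta> \<ge> 0\<close>
      by (intro add_mono mult_left_mono order.trans[OF s(2)] X XY s(1) mult_nonneg_nonneg nonneg) auto
    finally show "norm (T_map \<U> M - T_map \<V> M) \<le> 2 * k * s * k' * \<delta> * norm M"
      by (simp add: algebra_simps)
  qed
  then show ?thesis
    by (simp add: causal_influence_def[abs_def] diamond_dist_def)
qed

theorem lemma2p2:
  assumes "CARD('a::finite) * CARD('b::finite) = CARD('a'::finite) * CARD('b'::finite)"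
  shows "continuous_map
           (unitary_topology :: (('a \<times> 'b) oper \<Rightarrow> ('a' \<times> 'b') oper) topology)
           (top_of_set {0..2}) signalling
       \<and> continuous_map
           (unitary_topology :: (('a \<times> 'b) oper \<Rightarrow> ('a' \<times> 'b') oper) topology)
           (top_of_set {0..2}) causal_influence"
  by (intro conjI signalling_continuous causal_influence_continuous)

end
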